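(* Let $p>0$ be a natural number. Let $d>0$ be a natural number, and let $\mathcal{X}=(X,P^X,\vec{L}^X)$ and $\mathcal{Y}=(Y,P^Y,\vec{L}^Y)$ be finite structures (each with $p$ linear orders). Then there exists a finite structure $\mathcal{Z}=(Z,P^Z,\vec{L}^Z)$ with the following property: for each $d$-coloring of all copies of $\mathcal{X}$ in $\mathcal{Z}$, there exists a copy $\mathcal{Y}'$ of $\mathcal{Y}$ in $\mathcal{Z}$ such that all copies of $\mathcal{X}$ in $\mathcal{Y}'$ have the same color.
   Context: All orders (partial and linear) are strict. A natural number $p>0$ is fixed. A structure is a triple $(X,P,\vec{L})$, where $X$ is a set, $P$ is a partial order on $X$, and $\vec{L}=(L_0,\dots,L_{p-1})$ is a sequence of $p$ linear orders on $X$, each of which extends $P$. It is finite if $X$ is finite. Given structures $\mathcal{X}=(X,P^X,\vec{L}^X)$ and $\mathcal{Y}=(Y,P^Y,\vec{L}^Y)$, a function $f\colon X\to Y$ is an embedding if for all $x_1,x_2\in X$: $x_1P^Xx_2\Leftrightarrow f(x_1)P^Yf(x_2)$, and, for each $i<p$, $x_1L^X_ix_2\Leftrightarrow f(x_1)L^Y_if(x_2)$. A copy of $\mathcal{X}$ in $\mathcal{Y}$ is the image of an embedding of $\mathcal{X}$ into $\mathcal{Y}$ (taken with the structure restricted from $\mathcal{Y}$). A $d$-coloring is a coloring with $d$ colors. *)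

theory Defs
  imports "HOL-Library.FuncSet"
begin

record 'a ord_struct =
  points :: "'a set"
  po :: "'a rel"
  los :: "'a rel list"

text \<open>All orders are strict. The library's \<^const>\<open>strict_linear_order_on\<close> does not confine
  the relation to the underlying set, so this is required separately.\<close>

definition strict_partial_order_on :: "'a set \<Rightarrow> 'a rel \<Rightarrow> bool" where
  "strict_partial_order_on A r \<longleftrightarrow> r \<subseteq> A \<times> A \<and> trans r \<and> irrefl r"

definition is_struct :: "nat \<Rightarrow> 'a ord_struct \<Rightarrow> bool" where
  "is_struct p X \<longleftrightarrow>
     strict_partial_order_on (points X) (po X) \<and>
     length (los X) = p \<and>
     (\<forall>i<p. los X ! i \<subseteq> points X \<times> points X \<and>
            strict_linear_order_on (points X) (los X ! i) \<and>
            po X \<subseteq> los X ! i)"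

definition finite_struct :: "nat \<Rightarrow> 'a ord_struct \<Rightarrow> bool" where
  "finite_struct p X \<longleftrightarrow> is_struct p X \<and> finite (points X)"

text \<open>Injectivity of embeddings is not demanded: for \<open>p > 0\<close> it follows from preservation of the
  linear orders.\<close>

definition embedding :: "nat \<Rightarrow> 'a ord_struct \<Rightarrow> 'b ord_struct \<Rightarrow> ('a \<Rightarrow> 'b) \<Rightarrow> bool" where
  "embedding p X Y f \<longleftrightarrow>
     f \<in> points X \<rightarrow> points Y \<and>
     (\<forall>x1\<in>points X. \<forall>x2\<in>points X.
        ((x1, x2) \<in> po X \<longleftrightarrow> (f x1, f x2) \<in> po Y) \<and>
        (\<forall>i<p. (x1, x2) \<in> los X ! i \<longleftrightarrow> (f x1, f x2) \<in> los Y ! i))"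

definition restrict_struct :: "'a ord_struct \<Rightarrow> 'a set \<Rightarrow> 'a ord_struct" where
  "restrict_struct Y A =
     \<lparr>points = points Y \<inter> A, po = po Y \<inter> A \<times> A, los = map (\<lambda>L. L \<inter> A \<times> A) (los Y)\<rparr>"

text \<open>A copy is identified with the substructure induced on the image of an embedding. Two embeddings
  with the same image give the same copy.\<close>

definition copies :: "nat \<Rightarrow> 'a ord_struct \<Rightarrow> 'b ord_struct \<Rightarrow> 'b ord_struct set" where
  "copies p X Y = {restrict_struct Y (f ` points X) |f. embedding p X Y f}"

end

theory Submission
  imports Defs
begin

text \<open>
  For one linear order \<open>L\<close>, list the upsets of \<open>(X, P)\<close> as
  \<open>u 0 = {}, u 1, \<dots>, u k\<close>, ordered by the \<open>L\<close>-least point in which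
  two of them differ. A word \<open>s\<close> of length \<open>N\<close> over these upsets sends a point \<open>x\<close>
  to the set of positions \<open>j\<close> with \<open>x \<in> u (s ! j)\<close>. If all nonempty upsets
  occur in \<open>s\<close>, with first occurrences in the order of the list, this is an embedding of \<open>X\<close>
  into the power set of \<open>{..<N}\<close>, ordered by inclusion and by the least element of the
  symmetric difference. Taking preimages of upsets along an embedding of \<open>X\<close> into \<open>Y\<close> gives
  a word of the same kind, since the upset of \<open>Y\<close> generated by the image of \<open>A\<close> is the first
  one with preimage \<open>A\<close>. So the case \<open>p = 1\<close> follows from the Graham--Rothschild theorem
  for parameter words, which is deduced from the Hales--Jewett theorem.

  For more orders, embed into a product \<open>Z \<times> W\<close> with the product partial order, where
  \<open>Z\<close> takes care of the first \<open>p\<close> orders (compared by the first coordinate) and \<open>W\<close> of the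
  last one (compared by the second coordinate). A pair of embeddings into \<open>Z\<close> and \<open>W\<close> is one
  embedding into the product, so the product Ramsey argument applies.
\<close>

section \<open>Parameter words\<close>

text \<open>Letters below \<open>a\<close> are constants and \<open>a, \<dots>, b - 1\<close> are the parameters. After
  its first occurrence, the parameter \<open>a\<close> counts as one more constant for the rest of the word.\<close>

inductive param_word :: "nat \<Rightarrow> nat \<Rightarrow> nat list \<Rightarrow> bool" where
  param_word_Nil: "param_word a a []"
| param_word_old: "x < a \<Longrightarrow> param_word a b w \<Longrightarrow> param_word a b (x # w)"
| param_word_new: "param_word (Suc a) b w \<Longrightarrow> param_word a b (a # w)"

inductive_simps param_word_Nil_iff [simp]: "param_word a b []"
inductive_simps param_word_Cons_iff: "param_word a b (x # w)"

lemma param_word_letters: "param_word a b w \<Longrightarrow> a \<le> b \<and> set w \<subseteq> {..<b}"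
  by (induction rule: param_word.induct) auto

lemma param_word_append: "param_word a b u \<Longrightarrow> param_word b c v \<Longrightarrow> param_word a c (u @ v)"
  by (induction rule: param_word.induct) (auto intro: param_word.intros)

lemma param_word_const: "set w \<subseteq> {..<a} \<Longrightarrow> param_word a a w"
  by (induction w) (auto intro: param_word.intros)

lemma param_word_const_iff: "param_word a a w \<longleftrightarrow> set w \<subseteq> {..<a}"
  using param_word_const param_word_letters by blast

lemma param_word_upt: "param_word a (a + n) [a..<a + n]"
proof (induction n)
  case (Suc n)
  have "param_word (a + n) (Suc (a + n)) [a + n]" by (auto intro: param_word.intros)
  with Suc show ?case using param_word_append by fastforce
qed auto

text \<open>The cut is made at the first occurrence of the parameter \<open>z\<close>. Statements
  about prefixes and first occurrences rest on it.\<close>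

lemma param_word_split:
  assumes "param_word a b w" "a \<le> z" "z < b"
  shows "\<exists>u v. w = u @ z # v \<and> param_word a z u \<and> param_word (Suc z) b v"
  using assms
proof (induction rule: param_word.induct)
  case (param_word_old x a b w)
  then obtain u v where "w = u @ z # v" "param_word a z u" "param_word (Suc z) b v" by blast
  then show ?case using param_word_old(1) by (metis append_Cons param_word.param_word_old)
next
  case (param_word_new a b w)
  show ?case
  proof (cases "z = a")
    case True then show ?thesis using param_word_new(1) by (metis append_Nil param_word_Nil)
  next
    case False
    then obtain u v where "w = u @ z # v" "param_word (Suc a) z u" "param_word (Suc z) b v" 
      using param_word_new by fastforce
    then show ?thesis by (metis append_Cons param_word.param_word_new)
  qed
qed auto

text \<open>Closure under substitution: parameters appear in increasing order, so their images
  introduce the parameters of the target in the right order, and a repeated letter only repeats an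
  image already available.\<close>

lemma param_word_map:
  assumes "param_word a b w" "\<sigma> ` {..<a} \<subseteq> {..<a'}" "param_word a' c (map \<sigma> [a..<b])"
  shows "param_word a' c (map \<sigma> w)"
  using assms
proof (induction arbitrary: a' rule: param_word.induct)
  case (param_word_old x a b w)
  then show ?case by (auto intro: param_word.intros)
next
  case (param_word_new a b w)
  have "a < b" using param_word_letters[OF param_word_new(1)] by simp
  then have "param_word a' c (\<sigma> a # map \<sigma> [Suc a..<b])" 
    using param_word_new.prems(2) by (simp add: upt_conv_Cons)
  \<comment> \<open>The parameter \<open>a\<close> is sent either to a letter already available or
    to the next parameter of the target; only in the second case does \<open>a'\<close>
    grow.\<close>
  then consider "\<sigma> a < a'" "param_word a' c (map \<sigma> [Suc a..<b])"
    | "\<sigma> a = a'" "param_word (Suc a') c (map \<sigma> [Suc a..<b])"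
    by (auto simp: param_word_Cons_iff)
  then show ?case
  proof cases
    case 1
    then show ?thesis using param_word_new.IH[of a'] param_word_new.prems(1) 
      by (auto simp: lessThan_Suc intro: param_word.intros)
  next
    case 2
    then show ?thesis using param_word_new.IH[of "Suc a'"] param_word_new.prems(1) 
      by (force simp: lessThan_Suc intro: param_word.intros)
  qed
qed auto

text \<open>\<open>sub a g G\<close> is the composition of parameter words: the \<open>i\<close>-th parameter
  \<open>a + i\<close> of \<open>G\<close> is replaced by the letter \<open>g ! i\<close>.\<close>

definition ext :: "nat \<Rightarrow> nat list \<Rightarrow> nat \<Rightarrow> nat" where
  "ext a g x = (if x < a then x else g ! (x - a))"

abbreviation sub :: "nat \<Rightarrow> nat list \<Rightarrow> nat list \<Rightarrow> nat list" where
  "sub a g \<equiv> map (ext a g)"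

definition Words :: "nat \<Rightarrow> nat \<Rightarrow> nat \<Rightarrow> nat list set" where
  "Words a b n = {w. param_word a b w \<and> length w = n}"

lemma finite_Words: "finite (Words a b n)"
proof -
  have "Words a b n \<subseteq> {w. set w \<subseteq> {..<b} \<and> length w = n}"
    using param_word_letters by (auto simp: Words_def)
  then show ?thesis using finite_lists_length_eq[of "{..<b}" n] finite_subset by blast
qed

lemma map_ext_upt: "map (ext a g) [a..<a + length g] = g"
  by (rule nth_equalityI) (auto simp: ext_def)

lemma sub_Words:
  assumes "G \<in> Words a (a + m) n" "g \<in> Words a b m"
  shows "sub a g G \<in> Words a b n"
proof -
  have "param_word a b (sub a g G)"
  proof (rule param_word_map)
    show "param_word a (a + m) G" using assms by (simp add: Words_def)
    show "ext a g ` {..<a} \<subseteq> {..<a}" by (auto simp: ext_def)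
    show "param_word a b (map (ext a g) [a..<a + m])" 
      using assms map_ext_upt by (auto simp: Words_def)
  qed
  then show ?thesis using assms by (simp add: Words_def)
qed

text \<open>Associativity of composition. The bound on the letters of \<open>G\<close> keeps every
  index within the list \<open>g\<close>.\<close>

lemma sub_sub:
  assumes "set G \<subseteq> {..<a + length g}"
  shows "sub a h (sub a g G) = sub a (sub a h g) G"
  using assms by (auto simp: ext_def)

lemma Words_letters: "w \<in> Words a b n \<Longrightarrow> set w \<subseteq> {..<b}"
  using param_word_letters by (auto simp: Words_def)

text \<open>Makes room for the letter \<open>a\<close> as one more constant: the parameters
  \<open>a + i\<close> are renamed to \<open>Suc a + i\<close>, and the renamed word does not
  contain \<open>a\<close>.\<close>

definition shift :: "nat \<Rightarrow> nat \<Rightarrow> nat" where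
  "shift a x = (if x < a then x else Suc x)"

lemma shift_Words:
  assumes "w \<in> Words a (a + m) n"
  shows "map (shift a) w \<in> Words (Suc a) (Suc a + m) n"
proof -
  have 1: "map (shift a) [a..<a + m] = [Suc a..<Suc a + m]"
    by (rule nth_equalityI) (auto simp: shift_def simp del: upt_Suc)
  have "param_word (Suc a) (Suc a + m) (map (shift a) w)"
  proof (rule param_word_map)
    show "param_word a (a + m) w" using assms by (simp add: Words_def)
    show "shift a ` {..<a} \<subseteq> {..<Suc a}" by (auto simp: shift_def)
    show "param_word (Suc a) (Suc a + m) (map (shift a) [a..<a + m])" 
      unfolding 1 by (rule param_word_upt)
  qed
  then show ?thesis using assms by (simp add: Words_def)
qed

text \<open>The relation \<open>E\<close> says which words \<open>g\<close>, \<open>g'\<close> are to get the same colour; it is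
  \<open>\<lambda>_ _. True\<close> in the Graham--Rothschild theorem, and in the Hales--Jewett theorem, which
  is the case \<open>b = a\<close>.\<close>

definition arrows :: "nat \<Rightarrow> nat \<Rightarrow> nat \<Rightarrow> nat \<Rightarrow> (nat list \<Rightarrow> nat list \<Rightarrow> bool) \<Rightarrow> nat \<Rightarrow> bool" where
  "arrows d a b m E N \<longleftrightarrow> (\<forall>c \<in> Words a b N \<rightarrow> {..<d}. \<exists>G \<in> Words a (a + m) N.
     \<forall>g \<in> Words a b m. \<forall>g' \<in> Words a b m. E g g' \<longrightarrow> c (sub a g G) = c (sub a g' G))"

lemma recolour:
  assumes "finite C"
  shows "\<exists>e::'c \<Rightarrow> nat. inj_on e C \<and> e ` C = {..<card C}"
  using finite_imp_inj_to_nat_seg[OF assms] assms 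
  by (metis card_Collect_less_nat card_image lessThan_def)

text \<open>Colours from any finite set are allowed, so a word can be coloured by a whole list of
  colours, one for each of several extensions of it.\<close>

lemma arrowsD:
  fixes c :: "nat list \<Rightarrow> 'c"
  assumes "arrows (card C) a b m E N" "finite C" "c \<in> Words a b N \<rightarrow> C"
  obtains G where "G \<in> Words a (a + m) N"
    "\<And>g g'. g \<in> Words a b m \<Longrightarrow> g' \<in> Words a b m \<Longrightarrow> E g g' \<Longrightarrow> c (sub a g G) = c (sub a g' G)"
proof -
  obtain e :: "'c \<Rightarrow> nat" where e: "inj_on e C" "e ` C = {..<card C}" 
    using recolour assms(2) by blast
  then have "e \<circ> c \<in> Words a b N \<rightarrow> {..<card C}" using assms(3) by fastforce
  then obtain G where G: "G \<in> Words a (a + m) N" 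
    "\<forall>g \<in> Words a b m. \<forall>g' \<in> Words a b m. E g g' \<longrightarrow> e (c (sub a g G)) = e (c (sub a g' G))"
    using assms(1) unfolding arrows_def by fastforce
  show ?thesis
  proof (rule that[OF G(1)])
    fix g g' assume "g \<in> Words a b m" "g' \<in> Words a b m" "E g g'"
    moreover from this have "c (sub a g G) \<in> C" "c (sub a g' G) \<in> C"
      using assms(3) sub_Words[OF G(1)] by blast+
    ultimately show "c (sub a g G) = c (sub a g' G)" using G(2) e(1) by (meson inj_onD)
  qed
qed

lemma arrowsE:
  assumes "arrows d a b m E N" "c \<in> Words a b N \<rightarrow> {..<d}"
  obtains G where "G \<in> Words a (a + m) N"
    "\<And>g g'. g \<in> Words a b m \<Longrightarrow> g' \<in> Words a b m \<Longrightarrow> E g g' \<Longrightarrow> c (sub a g G) = c (sub a g' G)"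
proof -
  have "arrows (card {..<d}) a b m E N" using assms(1) by simp
  from arrowsD[OF this finite_lessThan assms(2)] that show ?thesis by blast
qed

section \<open>The Hales--Jewett theorem\<close>

definition flat :: "nat \<Rightarrow> nat \<Rightarrow> nat" where
  "flat a x = (if x = a then a - 1 else x)"

text \<open>Shelah's argument: among the \<open>M + 1\<close> blocks consisting of \<open>p\<close> letters \<open>a\<close> followed by
  \<open>M - p\<close> letters \<open>a - 1\<close>, two induce the same colouring of the tails. The variable word
  between them cannot tell the letters \<open>a\<close> and \<open>a - 1\<close> apart.\<close>

lemma shelah_fusion:
  assumes "0 < a"
  shows "\<exists>N. arrows d (Suc a) (Suc a) n (\<lambda>g g'. g' = map (flat a) g) N"
proof (induction n arbitrary: d)
  case 0
  have "arrows d (Suc a) (Suc a) 0 (\<lambda>g g'. g' = map (flat a) g) 0"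
    by (auto simp: arrows_def Words_def)
  then show ?case by blast
next
  case (Suc n)
  let ?A = "Suc a"
  \<comment> \<open>A tail is coloured by a list of colours, one for each letter put in place of the
    first parameter.\<close>
  define C where "C = {l. set l \<subseteq> {..<d} \<and> length l = ?A}"
  have finC: "finite C" unfolding C_def using finite_lists_length_eq by blast
  obtain N0 where N0: "arrows (card C) ?A ?A n (\<lambda>g g'. g' = map (flat a) g) N0"
    using Suc by blast
  \<comment> \<open>\<open>vs\<close> lists all tails, so the colourings of the tails are elements
    of \<open>C2\<close>, and the \<open>M + 1\<close> blocks outnumber them.\<close>
  obtain vs where vs: "set vs = Words ?A ?A N0" 
    using finite_list[OF finite_Words] by blast
  define C2 where "C2 = {l. set l \<subseteq> {..<d} \<and> length l = length vs}"
  have finC2: "finite C2" unfolding C2_def using finite_lists_length_eq by blast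
  define M where "M = card C2"
  have "arrows d ?A ?A (Suc n) (\<lambda>g g'. g' = map (flat a) g) (M + N0)"
    unfolding arrows_def
  proof
    fix c assume c: "c \<in> Words ?A ?A (M + N0) \<rightarrow> {..<d}"
    define P where "P p = replicate p a @ replicate (M - p) (a - 1)" for p
    have param_word: "u @ v \<in> Words ?A ?A (M + N0)" 
      if "set u \<subseteq> {..<?A}" "length u = M" "v \<in> Words ?A ?A N0" for u v
      using that by (auto simp: Words_def param_word_const_iff)
    have "(\<lambda>p. map (\<lambda>v. c (P p @ v)) vs) ` {..M} \<subseteq> C2"
    proof clarify
      fix p assume "p \<le> M"
      then have "c (P p @ v) < d" if "v \<in> set vs" for v
      proof -
        have "P p @ v \<in> Words ?A ?A (M + N0)" 
          using \<open>p \<le> M\<close> that vs by (intro param_word) (auto simp: P_def)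
        then show ?thesis using c by auto
      qed
      then show "map (\<lambda>v. c (P p @ v)) vs \<in> C2" by (auto simp: C2_def)
    qed
    then have "card ((\<lambda>p. map (\<lambda>v. c (P p @ v)) vs) ` {..M}) < card {..M}"
      using card_mono[OF finC2] by (force simp: M_def less_Suc_eq_le)
    then have "\<not> inj_on (\<lambda>p. map (\<lambda>v. c (P p @ v)) vs) {..M}" using pigeonhole by blast
    then obtain p q where pq: "p < q" "q \<le> M" "map (\<lambda>v. c (P p @ v)) vs = map (\<lambda>v. c (P q @ v)) vs"
      unfolding inj_on_def by (metis atMost_iff linorder_neqE_nat)
    \<comment> \<open>The middle stretch is the variable one: \<open>a\<close> gives block
      \<open>q\<close>, \<open>a - 1\<close> gives block \<open>p\<close>, and \<open>Suc a\<close>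
      will be the new parameter.\<close>
    define l where "l x = replicate p a @ replicate (q - p) x @ replicate (M - q) (a - 1)" for x
    have len: "length (l x) = M" for x using pq by (simp add: l_def)
    have la: "l a = P q" "l (a - 1) = P p"
      using pq by (simp_all add: l_def P_def replicate_add[symmetric] flip: append_assoc)
    have lw: "set (l x) \<subseteq> {..<?A}" if "x < ?A" for x using that by (auto simp: l_def)
    have "(\<lambda>v. map (\<lambda>x. c (l x @ v)) [0..<?A]) \<in> Words ?A ?A N0 \<rightarrow> C"
      using param_word lw len c unfolding C_def by (fastforce simp del: upt_Suc)
    then obtain G0 where G0: "G0 \<in> Words ?A (?A + n) N0" 
      and G0c: "\<And>g g'. \<lbrakk>g \<in> Words ?A ?A n; g' \<in> Words ?A ?A n; g' = map (flat a) g\<rbrakk> \<Longrightarrow> 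
        map (\<lambda>x. c (l x @ sub ?A g G0)) [0..<?A] = map (\<lambda>x. c (l x @ sub ?A g' G0)) [0..<?A]"
      using arrowsD[OF N0 finC] by blast
    define G where "G = l ?A @ map (shift ?A) G0"
    have "param_word ?A (Suc ?A) (replicate (q - p) ?A)" 
    proof -
      have "q - p = Suc (q - p - 1)" using pq by simp
      then have "replicate (q - p) ?A = ?A # replicate (q - p - 1) ?A" by (metis replicate_Suc)
      moreover have "param_word (Suc ?A) (Suc ?A) (replicate (q - p - 1) ?A)" by (rule param_word_const) auto
      ultimately show ?thesis by (simp add: param_word.intros)
    qed
    moreover have "param_word ?A ?A (replicate p a)" "param_word (Suc ?A) (Suc ?A) (replicate (M - q) (a - 1))"
      by (rule param_word_const; auto)+
    ultimately have "param_word ?A (Suc ?A) (l ?A)" unfolding l_def using param_word_append by blast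
    then have GW: "G \<in> Words ?A (?A + Suc n) (M + N0)"
      using shift_Words[OF G0] len param_word_append by (fastforce simp: G_def Words_def)
    have subG: "sub ?A (y # h) G = l y @ sub ?A h G0" for y h
    proof -
      have "sub ?A (y # h) (l ?A) = l y" by (auto simp: l_def ext_def)
      moreover have "sub ?A (y # h) (map (shift ?A) G0) = sub ?A h G0"
        by (auto simp: shift_def ext_def)
      ultimately show ?thesis by (simp add: G_def)
    qed
    have "c (sub ?A g G) = c (sub ?A (map (flat a) g) G)"
      if g: "g \<in> Words ?A ?A (Suc n)" for g
    proof -
      obtain y h where yh: "g = y # h" using g by (cases g) (auto simp: Words_def)
      have y: "y < ?A" and h: "h \<in> Words ?A ?A n" using g yh by (auto simp: Words_def param_word_const_iff)
      have fh: "map (flat a) h \<in> Words ?A ?A n" 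
        using h by (auto simp: Words_def param_word_const_iff flat_def)
      \<comment> \<open>First the tail is flattened with the letter \<open>y\<close> fixed. The
        flattened tail is again in \<open>vs\<close>, so the two blocks can then be exchanged in
        front of it.\<close>
      have 1: "c (l y @ sub ?A h G0) = c (l y @ sub ?A (map (flat a) h) G0)"
        using G0c[OF h fh] y by (metis (no_types, lifting) atLeastLessThan_iff le0 list.map_cong_pred map_eq_conv set_upt)
      have "sub ?A (map (flat a) h) G0 \<in> set vs" using vs sub_Words[OF G0 fh] by simp
      then have "c (l a @ sub ?A (map (flat a) h) G0) = c (l (a - 1) @ sub ?A (map (flat a) h) G0)"
        using pq(3) la by simp
      then have "c (l y @ sub ?A (map (flat a) h) G0) = c (l (flat a y) @ sub ?A (map (flat a) h) G0)"
        by (simp add: flat_def)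
      then show ?thesis using 1 yh subG by simp
    qed
    then show "\<exists>G\<in>Words ?A (?A + Suc n) (M + N0). \<forall>g\<in>Words ?A ?A (Suc n). \<forall>g'\<in>Words ?A ?A (Suc n).
      g' = map (flat a) g \<longrightarrow> c (sub ?A g G) = c (sub ?A g' G)"
      using GW by blast
  qed
  then show ?case by blast
qed

text \<open>Induction on the size of the alphabet. On the subspace given by
  \<open>shelah_fusion\<close> the letter \<open>a\<close> may be replaced by \<open>a - 1\<close>,
  so the colouring is determined by the words without \<open>a\<close>, and the smaller alphabet
  suffices.\<close>

lemma hales_jewett:
  assumes "0 < a"
  shows "\<exists>N. arrows d a a m (\<lambda>_ _. True) N"
  using assms
proof (induction a rule: nat_induct_non_zero)
  case 1
  have "arrows d 1 1 m (\<lambda>_ _. True) m"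
    unfolding arrows_def
  proof (intro ballI bexI)
    show "[1..<1 + m] \<in> Words 1 (1 + m) m" using param_word_upt[of 1 m] by (simp add: Words_def)
    fix g g' :: "nat list" and c :: "nat list \<Rightarrow> nat" assume "g \<in> Words 1 1 m" "g' \<in> Words 1 1 m"
    then have "g = replicate m 0" "g' = replicate m 0"
      by (auto simp: Words_def param_word_const_iff intro!: replicate_eqI)
    then show "True \<longrightarrow> c (sub 1 g [1..<1 + m]) = c (sub 1 g' [1..<1 + m])" by simp
  qed
  then show ?case by blast
next
  case (Suc a)
  let ?A = "Suc a"
  obtain n where n: "arrows d a a m (\<lambda>_ _. True) n" using Suc by blast
  obtain N where N: "arrows d ?A ?A n (\<lambda>g g'. g' = map (flat a) g) N" 
    using shelah_fusion[OF Suc(1)] by blast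
  have "arrows d ?A ?A m (\<lambda>_ _. True) N"
    unfolding arrows_def
  proof
    fix c assume c: "c \<in> Words ?A ?A N \<rightarrow> {..<d}"
    then obtain G where G: "G \<in> Words ?A (?A + n) N"
      and Gc: "\<And>g. \<lbrakk>g \<in> Words ?A ?A n; map (flat a) g \<in> Words ?A ?A n\<rbrakk>
         \<Longrightarrow> c (sub ?A g G) = c (sub ?A (map (flat a) g) G)"
      by (rule arrowsE[OF N]) blast
    have up: "w \<in> Words ?A ?A k" if "w \<in> Words a a k" for w k
      using that by (auto simp: Words_def param_word_const_iff)
    have c': "(\<lambda>w. c (sub ?A w G)) \<in> Words a a n \<rightarrow> {..<d}"
      using sub_Words[OF G] up c by blast
    obtain H where H: "H \<in> Words a (a + m) n"
      and Hc: "\<And>g g'. \<lbrakk>g \<in> Words a a m; g' \<in> Words a a m\<rbrakk> 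
        \<Longrightarrow> c (sub ?A (sub a g H) G) = c (sub ?A (sub a g' H) G)"
      by (rule arrowsE[OF n c']) blast
    let ?H = "map (shift a) H"
    have HW: "?H \<in> Words ?A (?A + m) n" by (rule shift_Words[OF H])
    have *: "map (flat a) g \<in> Words a a m \<and> c (sub ?A g (sub ?A ?H G)) = c (sub ?A (sub a (map (flat a) g) H) G)"
      if g: "g \<in> Words ?A ?A m" for g
    proof -
      have fl: "map (flat a) w \<in> Words a a k" if "w \<in> Words ?A ?A k" for w k
        using that \<open>0 < a\<close> by (fastforce simp: Words_def param_word_const_iff flat_def less_Suc_eq)
      have gH: "sub ?A g ?H \<in> Words ?A ?A n" using sub_Words HW g by blast
      have "sub ?A g (sub ?A ?H G) = sub ?A (sub ?A g ?H) G"
        using Words_letters[OF G] HW by (intro sub_sub) (simp add: Words_def)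
      moreover have "c (sub ?A (sub ?A g ?H) G) = c (sub ?A (map (flat a) (sub ?A g ?H)) G)"
        using Gc gH fl up by blast
      \<comment> \<open>The shifted word does not contain \<open>a\<close> itself, so flattening
        acts only through the letters of \<open>g\<close>.\<close>
      moreover have "map (flat a) (sub ?A g ?H) = sub a (map (flat a) g) H"
      proof -
        have "flat a (ext ?A g (shift a x)) = ext a (map (flat a) g) x" if "x < a + m" for x
          using that g by (auto simp: flat_def ext_def shift_def Words_def)
        then show ?thesis using Words_letters[OF H] by auto
      qed
      ultimately show ?thesis using fl[OF g] by (simp only:)
    qed
    show "\<exists>G\<in>Words ?A (?A + m) N. \<forall>g\<in>Words ?A ?A m. \<forall>g'\<in>Words ?A ?A m. 
        True \<longrightarrow> c (sub ?A g G) = c (sub ?A g' G)"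
    proof (intro bexI[of _ "sub ?A ?H G"] ballI impI)
      show "sub ?A ?H G \<in> Words ?A (?A + m) N" by (rule sub_Words[OF G HW])
      fix g g' assume "g \<in> Words ?A ?A m" "g' \<in> Words ?A ?A m"
      note g = this[THEN *]
      show "c (sub ?A g (sub ?A ?H G)) = c (sub ?A g' (sub ?A ?H G))"
        using Hc[OF g[THEN conjunct1]] g[THEN conjunct2] by (simp only:)
    qed
  qed
  then show ?case by blast
qed

section \<open>The Graham--Rothschild theorem\<close>

text \<open>If \<open>u\<close> is the part of \<open>g\<close> before its first parameter, then \<open>pre a G u\<close> is the part of
  \<open>sub a g G\<close> before its first parameter.\<close>

definition pre :: "nat \<Rightarrow> nat list \<Rightarrow> nat list \<Rightarrow> nat list" where
  "pre a G u = sub a u (takeWhile (\<lambda>x. x < a + length u) G)"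

text \<open>The first letter not below \<open>z\<close> is \<open>z\<close> itself, because larger
  parameters first occur later.\<close>

lemma param_word_takeWhile:
  assumes "param_word a b w" "a \<le> z" "z < b"
  shows "\<exists>v. w = takeWhile (\<lambda>x. x < z) w @ z # v" "length (takeWhile (\<lambda>x. x < z) w) < length w"
proof -
  obtain u v where uv: "w = u @ z # v" "param_word a z u" using param_word_split[OF assms] by blast
  then have "takeWhile (\<lambda>x. x < z) w = u" 
    using param_word_letters[OF uv(2)] by (subst uv(1), subst takeWhile_append2) auto
  then show "\<exists>v. w = takeWhile (\<lambda>x. x < z) w @ z # v" "length (takeWhile (\<lambda>x. x < z) w) < length w"
    using uv by auto
qed

text \<open>If \<open>g\<close> first reaches a letter not below \<open>t\<close> at position
  \<open>q\<close>, then the letters of \<open>G\<close> before the parameter \<open>a + q\<close>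
  become letters below \<open>t\<close>, and \<open>a + q\<close> becomes one that is not. The case
  \<open>t = a\<close> is the meaning of \<open>pre\<close>; larger \<open>t\<close> serve
  \<open>pre_pre\<close>.\<close>

lemma takeWhile_sub:
  assumes "param_word a (a + length g) G" "a \<le> t" "length (takeWhile (\<lambda>x. x < t) g) < length g"
  shows "takeWhile (\<lambda>x. x < t) (sub a g G) = pre a G (takeWhile (\<lambda>x. x < t) g)"
proof -
  define u where "u = takeWhile (\<lambda>x. x < t) g"
  define q where "q = length u"
  have q: "q < length g" "\<not> g ! q < t" 
    using assms(3) nth_length_takeWhile unfolding q_def u_def by blast+
  define G1 where "G1 = takeWhile (\<lambda>x. x < a + q) G"
  obtain v where v: "G = G1 @ (a + q) # v"
    using param_word_takeWhile(1)[OF assms(1), of "a + q"] q unfolding G1_def by auto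
  have u: "i < q \<Longrightarrow> u ! i = g ! i \<and> u ! i < t" for i
    unfolding q_def u_def by (metis nth_mem set_takeWhileD takeWhile_nth)
  have G1: "x \<in> set G1 \<Longrightarrow> x < a + q" for x using set_takeWhileD unfolding G1_def by fastforce
  have ext: "ext a g x = ext a u x \<and> ext a u x < t" if "x \<in> set G1" for x
  proof (cases "x < a")
    case False
    then have "x - a < q" using G1[OF that] by linarith
    then show ?thesis using u[of "x - a"] False by (simp add: ext_def)
  qed (use assms(2) in \<open>auto simp: ext_def\<close>)
  then have "sub a g G1 = sub a u G1" by simp
  moreover have "x < t" if "x \<in> set (sub a u G1)" for x using that ext by auto
  moreover have "\<not> ext a g (a + q) < t" using q by (simp add: ext_def)
  ultimately have "takeWhile (\<lambda>x. x < t) (sub a g G1 @ ext a g (a + q) # sub a g v) = sub a u G1"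
    by (metis append_Nil2 takeWhile.simps(2) takeWhile_append2)
  then show ?thesis unfolding pre_def u_def[symmetric] q_def[symmetric] G1_def[symmetric] 
    by (subst v) simp
qed

text \<open>Counterpart of \<open>sub_sub\<close> for prefixes; it lets a colouring of prefixes be
  pulled back along \<open>H\<close>.\<close>

lemma pre_pre:
  assumes "param_word a (a + length G) H" "param_word a (a + m) G" "length u < m"
  shows "pre a (sub a G H) u = pre a H (pre a G u)"
proof -
  define v where "v = takeWhile (\<lambda>x. x < a + length u) G"
  have "length v < length G" unfolding v_def using param_word_takeWhile(2)[OF assms(2)] assms(3) by simp
  then have "takeWhile (\<lambda>x. x < a + length u) (sub a G H) = pre a H v"
    using takeWhile_sub[OF assms(1), of "a + length u"] by (simp add: v_def)
  moreover have "sub a u (pre a H v) = pre a H (sub a u v)"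
    unfolding pre_def length_map by (rule sub_sub) (use set_takeWhileD in fastforce)
  ultimately show ?thesis by (simp add: pre_def v_def)
qed

text \<open>The parameters are introduced from the last to the first: Hales--Jewett makes the colour
  constant on the full words, and the prefixes are treated by induction.\<close>

lemma prefixes_by_length:
  fixes d :: nat
  assumes "0 < a"
  shows "\<exists>N. \<forall>c. (\<forall>u. c u < d) \<longrightarrow> (\<exists>G \<in> Words a (a + m) N. \<forall>u u'.
    set u \<subseteq> {..<a} \<longrightarrow> set u' \<subseteq> {..<a} \<longrightarrow> length u = length u' \<longrightarrow> length u < m \<longrightarrow> 
    c (pre a G u) = c (pre a G u'))"
proof (induction m)
  case 0
  have "[] \<in> Words a (a + 0) 0" by (simp add: Words_def)
  then show ?case by blast
next
  case (Suc m)
  then obtain n where n: "\<And>c. (\<And>u. c u < d) \<Longrightarrow> (\<exists>G \<in> Words a (a + m) n. \<forall>u u'.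
    set u \<subseteq> {..<a} \<longrightarrow> set u' \<subseteq> {..<a} \<longrightarrow> length u = length u' \<longrightarrow> length u < m \<longrightarrow> 
    c (pre a G u) = c (pre a G u'))" by blast
  obtain N where N: "arrows d a a n (\<lambda>_ _. True) N" using hales_jewett[OF assms] by blast
  show ?case
  proof (intro exI[of _ "Suc N"] allI impI)
    fix c :: "nat list \<Rightarrow> nat" assume c: "\<forall>u. c u < d"
    then have "c \<in> Words a a N \<rightarrow> {..<d}" by simp
    then obtain H where H: "H \<in> Words a (a + n) N"
      and Hc: "\<And>g g'. \<lbrakk>g \<in> Words a a n; g' \<in> Words a a n\<rbrakk> \<Longrightarrow> c (sub a g H) = c (sub a g' H)"
      by (rule arrowsE[OF N]) blast
    \<comment> \<open>The induction hypothesis is applied to the colouring pulled back along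
      \<open>H\<close>; this handles the words shorter than \<open>m\<close>.\<close>
    obtain G where G: "G \<in> Words a (a + m) n" and Gc: "\<And>u u'.
      \<lbrakk>set u \<subseteq> {..<a}; set u' \<subseteq> {..<a}; length u = length u'; length u < m\<rbrakk> \<Longrightarrow> 
      c (pre a H (pre a G u)) = c (pre a H (pre a G u'))" 
      using n[of "\<lambda>u. c (pre a H u)"] c by blast
    \<comment> \<open>The parameter \<open>a + m\<close> is an end marker: for a word of length
      \<open>m\<close>, the prefix of \<open>F\<close> is a full word of length \<open>N\<close>,
      where \<open>H\<close> has already made the colour constant.\<close>
    define F where "F = sub a G H @ [a + m]"
    have GH: "sub a G H \<in> Words a (a + m) N" using sub_Words[OF H G] .
    have "param_word (a + m) (Suc (a + m)) [a + m]" by (auto intro: param_word.intros)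
    then have F: "F \<in> Words a (a + Suc m) (Suc N)"
      using GH param_word_append by (auto simp: F_def Words_def)
    show "\<exists>G \<in> Words a (a + Suc m) (Suc N). \<forall>u u'.
      set u \<subseteq> {..<a} \<longrightarrow> set u' \<subseteq> {..<a} \<longrightarrow> length u = length u' \<longrightarrow> length u < Suc m \<longrightarrow> 
      c (pre a G u) = c (pre a G u')"
    proof (intro bexI[OF _ F] allI impI)
      fix u u' assume u: "set u \<subseteq> {..<a}" "set u' \<subseteq> {..<a}" "length u = length u'" "length u < Suc m"
      have tw: "pre a F w = pre a (sub a G H) w" if "length w < Suc m" for w
        using that by (simp add: pre_def F_def takeWhile_tail)
      show "c (pre a F u) = c (pre a F u')"
      proof (cases "length u < m")
        case True
        have "pre a F w = pre a H (pre a G w)" if "length w < m" for w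
          using pre_pre[of a G H m w] H G tw[of w] that by (simp add: Words_def)
        then show ?thesis using Gc[OF u(1-3) True] u(3) True by metis
      next
        case False
        have "pre a (sub a G H) w = sub a (sub a w G) H \<and> sub a w G \<in> Words a a n" 
          if "set w \<subseteq> {..<a}" "length w = m" for w
        proof -
          have "takeWhile (\<lambda>x. x < a + m) (sub a G H) = sub a G H"
            using Words_letters[OF GH] unfolding takeWhile_eq_all_conv by auto
          moreover have "sub a w (sub a G H) = sub a (sub a w G) H"
            using Words_letters[OF H] G by (intro sub_sub) (simp add: Words_def)
          ultimately have "pre a (sub a G H) w = sub a (sub a w G) H"
            unfolding pre_def that(2) by (simp only:)
          then show ?thesis using sub_Words[OF G, of w a] that by (simp add: Words_def param_word_const_iff)
        qed
        then have "pre a F w = sub a (sub a w G) H \<and> sub a w G \<in> Words a a n" 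
          if "set w \<subseteq> {..<a}" "length w = m" for w
          using that tw[of w] by simp
        moreover have "length u = m" "length u' = m" using u False by auto
        ultimately show ?thesis using Hc u by metis
      qed
    qed
  qed
qed

text \<open>The parameters are put, in increasing order, at the positions in \<open>J\<close>; all
  other positions get the constant \<open>0\<close>, whence \<open>0 < a\<close>.\<close>

lemma select_positions:
  assumes "0 < a"
  shows "J \<subseteq> {..<M} \<Longrightarrow> \<exists>G \<in> Words a (a + card J) M. 
    \<forall>j < card J. length (takeWhile (\<lambda>x. x < a + j) G) \<in> J"
proof (induction M arbitrary: J)
  case 0
  then show ?case by (auto simp: Words_def)
next
  case (Suc M)
  let ?J = "J - {M}"
  have "?J \<subseteq> {..<M}" using Suc.prems by auto
  then obtain G where G: "G \<in> Words a (a + card ?J) M" 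
    and Gj: "\<And>j. j < card ?J \<Longrightarrow> length (takeWhile (\<lambda>x. x < a + j) G) \<in> ?J"
    using Suc.IH by blast
  have tw: "takeWhile (\<lambda>x. x < a + j) (G @ [y]) = takeWhile (\<lambda>x. x < a + j) G" if "j < card ?J" for j y
  proof -
    obtain v where "G = takeWhile (\<lambda>x. x < a + j) G @ (a + j) # v" 
      using param_word_takeWhile(1)[of a "a + card ?J" G "a + j"] G \<open>j < card ?J\<close> by (auto simp: Words_def)
    then have "a + j \<in> set G" by (metis in_set_conv_decomp)
    then show ?thesis using takeWhile_append1[of "a + j" G "\<lambda>x. x < a + j"] by simp
  qed
  have fin: "finite J" using Suc.prems finite_subset by blast
  show ?case
  proof (cases "M \<in> J")
    case True
    let ?z = "a + card ?J"
    have card: "card J = Suc (card ?J)" using True fin by (metis card_Suc_Diff1)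
    have "param_word ?z (Suc ?z) [?z]" by (auto intro: param_word.intros)
    then have "G @ [?z] \<in> Words a (a + card J) (Suc M)" 
      using G param_word_append by (auto simp: Words_def card)
    moreover have "length (takeWhile (\<lambda>x. x < a + j) (G @ [?z])) \<in> J" if "j < card J" for j
    proof (cases "j < card ?J")
      case True
      then show ?thesis using tw Gj by auto
    next
      case False
      then have "j = card ?J" using that card by simp
      moreover have "takeWhile (\<lambda>x. x < ?z) (G @ [?z]) = G"
        using Words_letters[OF G] by (subst takeWhile_append2) auto
      ultimately show ?thesis using G True by (simp add: Words_def)
    qed
    ultimately show ?thesis by blast
  next
    case False
    have "param_word (a + card J) (a + card J) [0]" using assms by (simp add: param_word_const_iff)
    then have "G @ [0] \<in> Words a (a + card J) (Suc M)" 
      using G param_word_append False by (fastforce simp: Words_def)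
    then show ?thesis using tw Gj False by (intro bexI[of _ "G @ [0]"]) auto
  qed
qed

text \<open>After \<open>prefixes_by_length\<close> the colour of a prefix depends only on the
  length of the word substituted. Among \<open>d * m\<close> lengths, \<open>m\<close> share a
  colour, and \<open>select_positions\<close> gives a word that uses only these.\<close>

lemma prefixes_monochromatic:
  fixes d :: nat
  assumes "0 < a" "0 < d"
  shows "\<exists>N. \<forall>c. (\<forall>u. c u < d) \<longrightarrow> (\<exists>G \<in> Words a (a + m) N. \<forall>u u'.
    set u \<subseteq> {..<a} \<longrightarrow> set u' \<subseteq> {..<a} \<longrightarrow> length u < m \<longrightarrow> length u' < m \<longrightarrow> 
    c (pre a G u) = c (pre a G u'))"
proof -
  define M where "M = d * m"
  obtain N where N: "\<And>c. (\<And>u. c u < d) \<Longrightarrow> (\<exists>G \<in> Words a (a + M) N. \<forall>u u'.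
    set u \<subseteq> {..<a} \<longrightarrow> set u' \<subseteq> {..<a} \<longrightarrow> length u = length u' \<longrightarrow> length u < M \<longrightarrow> 
    c (pre a G u) = c (pre a G u'))"
    using prefixes_by_length[OF assms(1), of d M] by blast
  show ?thesis
  proof (intro exI[of _ N] allI impI)
    fix c :: "nat list \<Rightarrow> nat" assume c: "\<forall>u. c u < d"
    then obtain H where H: "H \<in> Words a (a + M) N" and Hc: "\<And>u u'.
      \<lbrakk>set u \<subseteq> {..<a}; set u' \<subseteq> {..<a}; length u = length u'; length u < M\<rbrakk> \<Longrightarrow>
      c (pre a H u) = c (pre a H u')" using N by blast
    \<comment> \<open>The word of zeros represents all words of length \<open>i\<close>.\<close>
    define \<chi> where "\<chi> i = c (pre a H (replicate i 0))" for i
    have "\<exists>J \<subseteq> {..<M}. card J = m \<and> (\<exists>e. \<forall>i \<in> J. \<chi> i = e)"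
    proof (cases "m = 0")
      case True
      then show ?thesis by (intro exI[of _ "{}"]) auto
    next
      case False
      have "\<exists>y\<in>{..<d}. card {..<M} \<le> card (\<chi> -` {y} \<inter> {..<M}) * card {..<d}"
        using c assms by (intro pigeonhole_card) (auto simp: \<chi>_def)
      then obtain y where "m \<le> card (\<chi> -` {y} \<inter> {..<M})" using assms by (auto simp: M_def mult.commute)
      then obtain J where "J \<subseteq> \<chi> -` {y} \<inter> {..<M}" "card J = m" 
        using obtain_subset_with_card_n by blast
      then show ?thesis by (intro exI[of _ J] conjI exI[of _ y]) auto
    qed
    then obtain J e where J: "J \<subseteq> {..<M}" "card J = m" "\<And>i. i \<in> J \<Longrightarrow> \<chi> i = e" by blast
    then obtain G where G: "G \<in> Words a (a + m) M" 
      and GJ: "\<And>j. j < m \<Longrightarrow> length (takeWhile (\<lambda>x. x < a + j) G) \<in> J"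
      using select_positions[OF assms(1) J(1)] by blast
    show "\<exists>G \<in> Words a (a + m) N. \<forall>u u'. set u \<subseteq> {..<a} \<longrightarrow> set u' \<subseteq> {..<a} 
      \<longrightarrow> length u < m \<longrightarrow> length u' < m \<longrightarrow> c (pre a G u) = c (pre a G u')"
    proof (intro bexI[OF _ sub_Words[OF H G]] allI impI)
      have *: "c (pre a (sub a G H) u) = e" if u: "set u \<subseteq> {..<a}" "length u < m" for u
      proof -
        let ?v = "pre a G u"
        have lv: "length ?v \<in> J" using GJ u by (simp add: pre_def)
        have "set ?v \<subseteq> {..<a}"
        proof
          fix x assume "x \<in> set ?v"
          then obtain y where "y < a + length u" "x = ext a u y" 
            using set_takeWhileD unfolding pre_def by fastforce
          then show "x \<in> {..<a}" using u(1) 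
            by (cases "y < a") (auto simp: ext_def subset_iff)
        qed
        then have "c (pre a H ?v) = \<chi> (length ?v)"
          unfolding \<chi>_def using lv J(1) assms(1) by (intro Hc) auto
        then show ?thesis using pre_pre[of a G H m u] H G J(3)[OF lv] u by (simp add: Words_def)
      qed
      fix u u' assume "set u \<subseteq> {..<a}" "set u' \<subseteq> {..<a}" "length u < m" "length u' < m"
      then show "c (pre a (sub a G H) u) = c (pre a (sub a G H) u')" using * by simp
    qed
  qed
qed

text \<open>Induction on \<open>m\<close> by the first letter of \<open>g\<close>. If it is a
  constant, the rest is left to the induction. If it is the parameter \<open>a\<close>, the prefix
  is empty, and the rest has \<open>k\<close> parameters over \<open>Suc a\<close> constants, so
  \<open>IH\<close> applies.\<close>

lemma depend_on_prefix:
  assumes IH: "\<And>a d m. 0 < a \<Longrightarrow> 0 < d \<Longrightarrow> \<exists>N. arrows d a (a + k) m (\<lambda>_ _. True) N"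
    and "0 < a" "0 < d"
  shows "\<exists>N. arrows d a (a + Suc k) m 
    (\<lambda>g g'. takeWhile (\<lambda>x. x < a) g = takeWhile (\<lambda>x. x < a) g') N"
  using \<open>0 < d\<close>
proof (induction m arbitrary: d)
  case 0
  have "arrows d a (a + Suc k) 0 (\<lambda>g g'. takeWhile (\<lambda>x. x < a) g = takeWhile (\<lambda>x. x < a) g') 0"
    by (auto simp: arrows_def Words_def)
  then show ?case by blast
next
  case (Suc m)
  let ?E = "\<lambda>g g'. takeWhile (\<lambda>x. x < a) g = takeWhile (\<lambda>x. x < a) g'"
  \<comment> \<open>One colour for each constant as first letter, so that a single word
    \<open>F\<close> works for all of them.\<close>
  define C where "C = {l. set l \<subseteq> {..<d} \<and> length l = a}"
  have finC: "finite C" unfolding C_def using finite_lists_length_eq by blast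
  have "replicate a 0 \<in> C" using Suc.prems by (auto simp: C_def)
  then have "0 < card C" using finC card_gt_0_iff by blast
  then obtain n where n: "arrows (card C) a (a + Suc k) m ?E n" using Suc.IH by blast
  obtain n' where n': "arrows d (Suc a) (Suc a + k) n (\<lambda>_ _. True) n'" 
    using IH[of "Suc a" d n] Suc.prems by auto
  have "arrows d a (a + Suc k) (Suc m) ?E (Suc n')"
    unfolding arrows_def
  proof
    fix c assume c: "c \<in> Words a (a + Suc k) (Suc n') \<rightarrow> {..<d}"
    have "(\<lambda>v. c (a # v)) \<in> Words (Suc a) (Suc a + k) n' \<rightarrow> {..<d}"
    proof
      fix v assume "v \<in> Words (Suc a) (Suc a + k) n'"
      then have "a # v \<in> Words a (a + Suc k) (Suc n')" by (auto simp: Words_def intro: param_word.intros)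
      then show "c (a # v) \<in> {..<d}" using c by blast
    qed
    then obtain H where H: "H \<in> Words (Suc a) (Suc a + n) n'" and 
      Hc: "\<And>g g'. \<lbrakk>g \<in> Words (Suc a) (Suc a + k) n; g' \<in> Words (Suc a) (Suc a + k) n\<rbrakk> \<Longrightarrow> 
        c (a # sub (Suc a) g H) = c (a # sub (Suc a) g' H)"
      by (rule arrowsE[OF n']) blast
    \<comment> \<open>The letter \<open>a\<close>, a constant of \<open>H\<close>, is replaced by
      the first letter \<open>x\<close>, and the parameters of \<open>H\<close> by the letters of
      \<open>w\<close>.\<close>
    have HW: "x # sub a (x # w) H \<in> Words a (a + Suc k) (Suc n')" 
      if "x < a" "w \<in> Words a (a + Suc k) n" for x w
    proof -
      have "param_word a (a + Suc k) (sub a (x # w) H)"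
      proof (rule param_word_map)
        show "param_word (Suc a) (Suc a + n) H" using H by (simp add: Words_def)
        show "ext a (x # w) ` {..<Suc a} \<subseteq> {..<a}" using \<open>x < a\<close> by (auto simp: ext_def less_Suc_eq)
        have "sub a (x # w) [Suc a..<Suc a + n] = w"
          using that by (intro nth_equalityI) (auto simp: ext_def Words_def simp del: upt_Suc)
        then show "param_word a (a + Suc k) (sub a (x # w) [Suc a..<Suc a + n])" 
          using that by (simp add: Words_def)
      qed
      then show ?thesis using H that by (auto simp: Words_def intro: param_word.intros)
    qed
    have "(\<lambda>w. map (\<lambda>x. c (x # sub a (x # w) H)) [0..<a]) \<in> Words a (a + Suc k) n \<rightarrow> C"
      using HW c unfolding C_def by fastforce
    then obtain F where F: "F \<in> Words a (a + m) n" and 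
      Fc: "\<And>g g'. \<lbrakk>g \<in> Words a (a + Suc k) m; g' \<in> Words a (a + Suc k) m; ?E g g'\<rbrakk> \<Longrightarrow> 
        map (\<lambda>x. c (x # sub a (x # sub a g F) H)) [0..<a] = map (\<lambda>x. c (x # sub a (x # sub a g' F) H)) [0..<a]"
      by (rule arrowsD[OF n finC]) blast
    let ?F = "map (shift a) F"
    have FW: "?F \<in> Words (Suc a) (Suc a + m) n" by (rule shift_Words[OF F])
    define G where "G = a # sub (Suc a) ?F H"
    have GW: "G \<in> Words a (a + Suc m) (Suc n')"
      using sub_Words[OF H FW] by (auto simp: G_def Words_def intro: param_word.intros)
    have new: "c (sub a (a # h) G) = c (sub a (a # h') G)" 
      if "h \<in> Words (Suc a) (Suc a + k) m" "h' \<in> Words (Suc a) (Suc a + k) m" for h h'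
    proof -
      have "sub a (a # h) G = a # sub (Suc a) (sub (Suc a) h ?F) H" for h
      proof -
        have "ext a (a # h) = ext (Suc a) h" 
          by (auto simp: ext_def fun_eq_iff less_Suc_eq nth_Cons split: nat.split)
            (metis Suc_diff_Suc Suc_leI diff_Suc_Suc le_neq_implies_less not_less_eq nat.inject linorder_not_less)
        moreover have "sub (Suc a) h (sub (Suc a) ?F H) = sub (Suc a) (sub (Suc a) h ?F) H"
          using Words_letters[OF H] FW by (intro sub_sub) (simp add: Words_def)
        ultimately show ?thesis by (simp only: G_def list.map(2)) (simp add: ext_def)
      qed
      then show ?thesis using Hc[OF sub_Words[OF FW that(1)] sub_Words[OF FW that(2)]] by (simp only:)
    qed
    have old: "sub a (y # h) G = y # sub a (y # sub a h F) H" if "y < a" for y h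
    proof -
      have "ext a (y # h) (ext (Suc a) ?F x) = ext a (y # sub a h F) x" if "x < Suc a + n" for x
      proof -
        have "x < a \<or> x = a \<or> (\<exists>i. x = Suc (a + i) \<and> i < n)" using that by presburger
        then consider "x < a" | "x = a" | i where "x = Suc (a + i)" "i < n" by blast
        then show ?thesis 
        proof cases
          case 3
          then show ?thesis using F \<open>y < a\<close> 
            by (auto simp: ext_def shift_def Words_def Suc_diff_le)
        qed (auto simp: ext_def)
      qed
      then have "sub a (y # h) (sub (Suc a) ?F H) = sub a (y # sub a h F) H"
        using Words_letters[OF H] by auto
      moreover have "ext a (y # h) a = y" by (simp add: ext_def)
      ultimately show ?thesis by (simp only: G_def list.map(2))
    qed
    have "c (sub a g G) = c (sub a g' G)" 
      if g: "g \<in> Words a (a + Suc k) (Suc m)" "g' \<in> Words a (a + Suc k) (Suc m)" "?E g g'" for g g'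
    proof -
      obtain y h where yh: "g = y # h" using g by (cases g) (auto simp: Words_def)
      obtain y' h' where yh': "g' = y' # h'" using g by (cases g') (auto simp: Words_def)
      have y: "y < a \<and> h \<in> Words a (a + Suc k) m \<or> y = a \<and> h \<in> Words (Suc a) (Suc a + k) m"
        using g yh by (auto simp: Words_def param_word_Cons_iff)
      have y': "y' < a \<and> h' \<in> Words a (a + Suc k) m \<or> y' = a \<and> h' \<in> Words (Suc a) (Suc a + k) m"
        using g yh' by (auto simp: Words_def param_word_Cons_iff)
      show ?thesis
      proof (cases "y < a")
        case True
        then have *: "y' = y" "?E h h'" using g(3) yh yh' by (auto split: if_splits)
        then have "c (y # sub a (y # sub a h F) H) = c (y # sub a (y # sub a h' F) H)"
          using Fc[of h h'] y y' True by auto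
        then show ?thesis using old[OF True] yh yh' * by (simp only:)
      next
        case False
        then have "y' = a" "y = a" using g(3) yh yh' y y' by (auto split: if_splits)
        then show ?thesis using new y y' yh yh' by blast
      qed
    qed
    then show "\<exists>G\<in>Words a (a + Suc m) (Suc n'). \<forall>g\<in>Words a (a + Suc k) (Suc m). 
      \<forall>g'\<in>Words a (a + Suc k) (Suc m). ?E g g' \<longrightarrow> c (sub a g G) = c (sub a g' G)"
      using GW by blast
  qed
  then show ?case by blast
qed

text \<open>Induction on the number \<open>k\<close> of parameters: \<open>depend_on_prefix\<close>
  turns the colouring into one of the prefixes before the first parameter, and
  \<open>prefixes_monochromatic\<close> makes that one constant.\<close>

lemma graham_rothschild:
  assumes "0 < a" "0 < d"
  shows "\<exists>N. arrows d a (a + k) m (\<lambda>_ _. True) N"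
  using assms
proof (induction k arbitrary: a d m)
  case 0
  then show ?case using hales_jewett by simp
next
  case (Suc k)
  let ?b = "a + Suc k"
  let ?tw = "takeWhile (\<lambda>x. x < a)"
  obtain n where n: "\<And>c. (\<And>u. c u < d) \<Longrightarrow> (\<exists>G \<in> Words a (a + m) n. \<forall>u u'.
    set u \<subseteq> {..<a} \<longrightarrow> set u' \<subseteq> {..<a} \<longrightarrow> length u < m \<longrightarrow> length u' < m \<longrightarrow> 
    c (pre a G u) = c (pre a G u'))"
    using prefixes_monochromatic[OF Suc.prems, of m] by blast
  obtain N where N: "arrows d a ?b n (\<lambda>g g'. ?tw g = ?tw g') N"
    using depend_on_prefix[OF Suc.IH Suc.prems] by blast
  have "arrows d a ?b m (\<lambda>_ _. True) N"
    unfolding arrows_def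
  proof
    fix c assume c: "c \<in> Words a ?b N \<rightarrow> {..<d}"
    then obtain H where H: "H \<in> Words a (a + n) N" and
      Hc: "\<And>g g'. \<lbrakk>g \<in> Words a ?b n; g' \<in> Words a ?b n; ?tw g = ?tw g'\<rbrakk> \<Longrightarrow> c (sub a g H) = c (sub a g' H)"
      by (rule arrowsE[OF N]) blast
    define ok where "ok u g \<longleftrightarrow> g \<in> Words a ?b n \<and> ?tw g = u" for u g
    \<comment> \<open>The colouring of prefixes, read off at any word with that prefix. The value
      \<open>0\<close> at other lists keeps \<open>c'\<close> below \<open>d\<close>
      everywhere.\<close>
    define c' where "c' u = (if \<exists>g. ok u g then c (sub a (SOME g. ok u g) H) else 0)" for u
    have c'g: "c' (?tw g) = c (sub a g H)" if "g \<in> Words a ?b n" for g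
    proof -
      have *: "ok (?tw g) g" using that by (simp add: ok_def)
      then have "ok (?tw g) (SOME h. ok (?tw g) h)" by (rule someI)
      then have "c (sub a (SOME h. ok (?tw g) h) H) = c (sub a g H)" 
        by (intro Hc that) (auto simp: ok_def)
      moreover have "\<exists>h. ok (?tw g) h" using * by blast
      ultimately show ?thesis by (simp add: c'_def)
    qed
    have "c' u < d" for u
    proof (cases "\<exists>g. ok u g")
      case True
      then obtain g where "g \<in> Words a ?b n" "u = ?tw g" by (auto simp: ok_def)
      then show ?thesis using c'g[of g] c sub_Words[OF H, of g ?b] by auto
    qed (use Suc.prems in \<open>simp add: c'_def\<close>)
    then obtain G where G: "G \<in> Words a (a + m) n" and Gc: "\<And>u u'.
      \<lbrakk>set u \<subseteq> {..<a}; set u' \<subseteq> {..<a}; length u < m; length u' < m\<rbrakk> \<Longrightarrow>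
      c' (pre a G u) = c' (pre a G u')" using n by blast
    have *: "c (sub a g (sub a G H)) = c' (pre a G (?tw g)) \<and> length (?tw g) < m" 
      if g: "g \<in> Words a ?b m" for g
    proof -
      have lg: "length g = m" using g by (simp add: Words_def)
      have lt: "length (?tw g) < length g" using param_word_takeWhile(2)[of a ?b g a] g by (simp add: Words_def)
      have "?tw (sub a g G) = pre a G (?tw g)" 
        using takeWhile_sub[of a g G a] G lg lt by (simp add: Words_def)
      moreover have "sub a g (sub a G H) = sub a (sub a g G) H"
        using Words_letters[OF H] G by (intro sub_sub) (simp add: Words_def)
      ultimately show ?thesis using c'g[OF sub_Words[OF G g]] lg lt by (simp only:)
    qed
    show "\<exists>G\<in>Words a (a + m) N. \<forall>g\<in>Words a ?b m. \<forall>g'\<in>Words a ?b m. 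
      True \<longrightarrow> c (sub a g G) = c (sub a g' G)"
    proof (intro bexI[OF _ sub_Words[OF H G]] ballI impI)
      fix g g' assume "g \<in> Words a ?b m" "g' \<in> Words a ?b m"
      note this[THEN *]
      moreover have "set (?tw h) \<subseteq> {..<a}" for h using set_takeWhileD by fastforce
      ultimately show "c (sub a g (sub a G H)) = c (sub a g' (sub a G H))" 
        using Gc[of "?tw g" "?tw g'"] by (simp only:)
    qed
  qed
  then show ?case by blast
qed

section \<open>Posets with one linear extension\<close>

text \<open>Extensionality leaves one function per embedding, so \<open>Emb\<close> is finite for
  finite structures.\<close>

definition Emb :: "nat \<Rightarrow> 'a ord_struct \<Rightarrow> 'b ord_struct \<Rightarrow> ('a \<Rightarrow> 'b) set" where
  "Emb p X Y = {f \<in> extensional (points X). embedding p X Y f}"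

text \<open>Embeddings are coloured rather than copies, because a pair of embeddings is an embedding
  into the product. Copies return only in the final theorem.\<close>

definition ramsey :: "nat \<Rightarrow> nat \<Rightarrow> 'a ord_struct \<Rightarrow> 'b ord_struct \<Rightarrow> 'c ord_struct \<Rightarrow> bool" where
  "ramsey p d X Y Z \<longleftrightarrow> finite_struct p Z \<and> (\<forall>c \<in> Emb p X Z \<rightarrow> {..<d}. \<exists>g. embedding p Y Z g \<and>
     (\<forall>f f'. embedding p X Y f \<longrightarrow> embedding p X Y f' \<longrightarrow> 
        c (compose (points X) g f) = c (compose (points X) g f')))"

lemma embedding_cong:
  assumes "\<And>x. x \<in> points X \<Longrightarrow> f x = g x"
  shows "embedding p X Y f \<longleftrightarrow> embedding p X Y g"
  using assms by (auto simp: embedding_def Pi_iff)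

lemma embedding_comp:
  "embedding p X Y f \<Longrightarrow> embedding p Y Z g \<Longrightarrow> embedding p X Z (\<lambda>x. g (f x))"
  by (auto simp: embedding_def Pi_iff)

lemma restrict_Emb: "embedding p X Y f \<Longrightarrow> restrict f (points X) \<in> Emb p X Y"
  unfolding Emb_def using embedding_cong[of X "restrict f (points X)" f p Y] by auto

lemma compose_Emb:
  "embedding p X Y f \<Longrightarrow> embedding p Y Z g \<Longrightarrow> compose (points X) g f \<in> Emb p X Z"
  using restrict_Emb[OF embedding_comp] by (simp add: compose_def)

text \<open>Compares by the \<open>r\<close>-least point of the symmetric difference.\<close>

definition set_less :: "'a rel \<Rightarrow> 'a set \<Rightarrow> 'a set \<Rightarrow> bool" where
  "set_less r A B \<longleftrightarrow> (\<exists>m \<in> B - A. \<forall>i. (i, m) \<in> r \<longrightarrow> (i \<in> A \<longleftrightarrow> i \<in> B))"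

lemma set_less_irrefl: "\<not> set_less r A A"
  by (simp add: set_less_def)

text \<open>Of the two deciding points \<open>m\<close> and \<open>n\<close>, the
  \<open>r\<close>-smaller one decides between \<open>A\<close> and \<open>C\<close>.\<close>

lemma set_less_trans:
  assumes "trans r" "total_on V r" "B \<subseteq> V" "C \<subseteq> V" "set_less r A B" "set_less r B C"
  shows "set_less r A C"
proof -
  obtain m where m: "m \<in> B - A" "\<And>i. (i, m) \<in> r \<Longrightarrow> i \<in> A \<longleftrightarrow> i \<in> B"
    using assms(5) unfolding set_less_def by blast
  obtain n where n: "n \<in> C - B" "\<And>i. (i, n) \<in> r \<Longrightarrow> i \<in> B \<longleftrightarrow> i \<in> C"
    using assms(6) unfolding set_less_def by blast
  have "m \<noteq> n" "m \<in> V" "n \<in> V" using m n assms by blast+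
  then consider "(m, n) \<in> r" | "(n, m) \<in> r" using assms(2) by (auto simp: total_on_def)
  then show ?thesis
  proof cases
    case 1
    then have "m \<in> C - A" using m n by blast
    moreover have "i \<in> A \<longleftrightarrow> i \<in> C" if "(i, m) \<in> r" for i 
      using that m(2) n(2) transD[OF assms(1) that 1] by blast
    ultimately show ?thesis unfolding set_less_def by blast
  next
    case 2
    then have "n \<in> C - A" using m n by blast
    moreover have "i \<in> A \<longleftrightarrow> i \<in> C" if "(i, n) \<in> r" for i 
      using that m(2) n(2) transD[OF assms(1) that 2] by blast
    ultimately show ?thesis unfolding set_less_def by blast
  qed
qed

lemma set_less_total:
  assumes "trans r" "irrefl r" "total_on V r" "finite V" "A \<subseteq> V" "B \<subseteq> V" "A \<noteq> B"
  shows "set_less r A B \<or> set_less r B A"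
proof -
  let ?D = "(A - B) \<union> (B - A)"
  have "asymp_on ?D (\<lambda>x y. (x, y) \<in> r)" "transp_on ?D (\<lambda>x y. (x, y) \<in> r)"
    using assms(1,2) by (auto simp: asymp_on_def transp_on_def irrefl_def dest: transD)
  moreover have "finite ?D" "?D \<noteq> {}" using assms finite_subset[of _ V] by auto
  ultimately obtain m where m: "m \<in> ?D" "\<forall>x\<in>?D. x \<noteq> m \<longrightarrow> (x, m) \<notin> r"
    using Finite_Set.bex_min_element[of ?D "\<lambda>x y. (x, y) \<in> r"] by blast
  have "i \<in> A \<longleftrightarrow> i \<in> B" if "(i, m) \<in> r" for i 
  proof -
    have "i \<noteq> m" using that assms(2) by (auto simp: irrefl_def)
    then show ?thesis using m(2) that by blast
  qed
  with m(1) show ?thesis unfolding set_less_def by blast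
qed

text \<open>Elements are numbered by how many elements lie below them; \<open>u\<close> inverts this
  rank.\<close>

lemma enumerate_finite_order:
  assumes "finite U" and irrefl: "\<And>A. \<not> R A A"
    and trans: "\<And>A B C. \<lbrakk>A \<in> U; B \<in> U; C \<in> U; R A B; R B C\<rbrakk> \<Longrightarrow> R A C"
    and total: "\<And>A B. \<lbrakk>A \<in> U; B \<in> U; A \<noteq> B\<rbrakk> \<Longrightarrow> R A B \<or> R B A"
  shows "\<exists>u. bij_betw u {..<card U} U \<and> (\<forall>i < card U. \<forall>j < card U. R (u i) (u j) \<longleftrightarrow> i < j)"
proof -
  define rk where "rk A = card {B \<in> U. R B A}" for A
  have mono: "rk A < rk B" if "A \<in> U" "B \<in> U" "R A B" for A B
  proof -
    have "{C \<in> U. R C A} \<subset> {C \<in> U. R C B}" using that irrefl[of A] trans[of _ A B] by blast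
    then show ?thesis unfolding rk_def using assms(1) by (intro psubset_card_mono) auto
  qed
  have inj: "inj_on rk U"
    by (rule inj_onI) (metis mono total less_irrefl)
  have "rk A < card U" if "A \<in> U" for A
    unfolding rk_def using that assms(1) irrefl by (intro psubset_card_mono) auto
  then have "rk ` U = {..<card U}" 
    using inj by (intro card_subset_eq) (auto simp: card_image)
  then have bij: "bij_betw rk U {..<card U}" using inj by (simp add: bij_betw_def)
  let ?u = "inv_into U rk"
  have "R (?u i) (?u j) \<longleftrightarrow> i < j" if "i < card U" "j < card U" for i j
  proof -
    have "?u i \<in> U" "?u j \<in> U" "rk (?u i) = i" "rk (?u j) = j"
      using that bij by (auto simp: bij_betw_def inv_into_into f_inv_into_f)
    then show ?thesis by (metis mono total less_irrefl less_asym)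
  qed
  then show ?thesis using bij_betw_inv_into[OF bij] by blast
qed

section \<open>Enumerating the upsets of a finite poset\<close>

definition upsets :: "'a set \<Rightarrow> 'a rel \<Rightarrow> 'a set set" where
  "upsets V P = {A. A \<subseteq> V \<and> (\<forall>x \<in> A. \<forall>y. (x, y) \<in> P \<longrightarrow> y \<in> A)}"

text \<open>The empty upset has number \<open>0\<close>, the only constant in
  \<open>Words 1 (1 + k) N\<close>; the \<open>k\<close> nonempty upsets are the parameters.\<close>

definition upset_enum :: "'a ord_struct \<Rightarrow> nat \<Rightarrow> (nat \<Rightarrow> 'a set) \<Rightarrow> bool" where
  "upset_enum X k u \<longleftrightarrow> u ` {..k} = upsets (points X) (po X) \<and> u 0 = {} \<and> 
     (\<forall>i \<le> k. \<forall>j \<le> k. set_less (los X ! 0) (u i) (u j) \<longleftrightarrow> i < j)"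

lemma finite_struct_1D:
  assumes "finite_struct 1 X"
  shows "finite (points X)" "trans (po X)" "irrefl (po X)" "po X \<subseteq> points X \<times> points X"
    "los X ! 0 \<subseteq> points X \<times> points X" "trans (los X ! 0)" "irrefl (los X ! 0)" 
    "total_on (points X) (los X ! 0)" "po X \<subseteq> los X ! 0"
  using assms by (auto simp: finite_struct_def is_struct_def strict_partial_order_on_def 
      strict_linear_order_on_def)

lemma upset_enum_ex:
  assumes "finite_struct 1 X"
  shows "\<exists>k u. upset_enum X k u"
proof -
  note X = finite_struct_1D[OF assms]
  let ?U = "upsets (points X) (po X)"
  have sub: "A \<subseteq> points X" if "A \<in> ?U" for A using that by (simp add: upsets_def)
  have fin: "finite ?U" using X(1) sub by (auto intro: finite_subset[of _ "Pow (points X)"])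
  have emp: "{} \<in> ?U" by (simp add: upsets_def)
  have "\<exists>u. bij_betw u {..<card ?U} ?U \<and> 
    (\<forall>i < card ?U. \<forall>j < card ?U. set_less (los X ! 0) (u i) (u j) \<longleftrightarrow> i < j)"
    using fin set_less_irrefl set_less_trans[OF X(6,8) sub sub] set_less_total[OF X(6-8,1) sub sub] 
    by (rule enumerate_finite_order) auto
  then obtain u where u: "bij_betw u {..<card ?U} ?U" 
    "\<And>i j. i < card ?U \<Longrightarrow> j < card ?U \<Longrightarrow> set_less (los X ! 0) (u i) (u j) \<longleftrightarrow> i < j" by blast
  have "card ?U > 0" using fin emp card_gt_0_iff by blast
  then obtain k where k: "card ?U = Suc k" using gr0_implies_Suc by blast
  obtain i where i: "i < Suc k" "u i = {}" 
    using emp u(1) k unfolding bij_betw_def by (metis imageE lessThan_iff)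
  then have "\<not> 0 < i" using u(2)[of 0 i] k by (auto simp: set_less_def)
  then have "u 0 = {}" using i by simp
  then have "upset_enum X k u" using u k 
    by (auto simp: upset_enum_def bij_betw_def lessThan_Suc_atMost less_Suc_eq_le)
  then show ?thesis by blast
qed

section \<open>Words over upsets as embeddings into a cube\<close>

lemma param_word_criterion:
  assumes "a \<le> b" "set w \<subseteq> {..<b}" "{a..<b} \<subseteq> set w" 
    "\<And>i y. i < length w \<Longrightarrow> a \<le> y \<Longrightarrow> y < w ! i \<Longrightarrow> \<exists>j < i. w ! j = y"
  shows "param_word a b w"
  using assms
proof (induction w arbitrary: a)
  case (Cons x w)
  show ?case
  proof (cases "x < a")
    case True
    have "param_word a b w"
    proof (rule Cons.IH)
      show "\<exists>j<i. w ! j = y" if iy: "i < length w" "a \<le> y" "y < w ! i" for i y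
      proof -
        obtain j where "j < Suc i" "(x # w) ! j = y" 
          using Cons.prems(4)[of "Suc i" y] iy by auto
        then show ?thesis using True iy by (cases j) auto
      qed
    qed (use Cons.prems True in \<open>auto simp: subset_iff\<close>)
    then show ?thesis using True by (rule param_word_old[rotated])
  next
    case False
    then have x: "x = a" using Cons.prems(4)[of 0 a] by force
    have "param_word (Suc a) b w"
    proof (rule Cons.IH)
      show "\<exists>j<i. w ! j = y" if iy: "i < length w" "Suc a \<le> y" "y < w ! i" for i y
      proof -
        obtain j where "j < Suc i" "(x # w) ! j = y" 
          using Cons.prems(4)[of "Suc i" y] iy by auto
        then show ?thesis using x iy by (cases j) auto
      qed
      show "{Suc a..<b} \<subseteq> set w" 
      proof
        fix t assume t: "t \<in> {Suc a..<b}"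
        then have "t \<in> {a..<b}" by simp
        then have "t \<in> set (x # w)" using Cons.prems(3) by blast
        then show "t \<in> set w" using t x by auto
      qed
    qed (use Cons.prems x in auto)
    then show ?thesis using x param_word_new by blast
  qed
qed auto

text \<open>Together with \<open>param_word_criterion\<close>, it makes the order of first
  occurrences available position by position.\<close>

lemma param_word_first_occurrence:
  assumes "param_word a b w" "i < length w" "a \<le> y" "y < w ! i"
  shows "\<exists>j < i. w ! j = y"
proof -
  have "w ! i < b" using param_word_letters[OF assms(1)] assms(2) nth_mem by blast
  then obtain u v where uv: "w = u @ y # v" "param_word a y u" using param_word_split[OF assms(1,3)] assms(4) by auto
  have "i > length u"
  proof (rule ccontr)
    assume "\<not> length u < i"
    then consider "i = length u" | "i < length u" "u ! i < y" 
      using param_word_letters[OF uv(2)] nth_mem[of i u] by fastforce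
    then show False using assms(4) uv(1) by cases (auto simp: nth_append)
  qed
  then show ?thesis using uv by (intro exI[of _ "length u"]) auto
qed

definition cube :: "nat \<Rightarrow> nat set ord_struct" where
  "cube N = \<lparr>points = Pow {..<N}, po = {(S, T). S \<subset> T \<and> T \<subseteq> {..<N}}, 
     los = [{(S, T). S \<subseteq> {..<N} \<and> T \<subseteq> {..<N} \<and> set_less less_than S T}]\<rparr>"

lemma finite_struct_cube: "finite_struct 1 (cube N)"
proof -
  have nat: "trans less_than" "irrefl less_than" "total_on {..<N} less_than"
    by (auto simp: irrefl_def total_on_def trans_less_than)
  have "trans {(S, T). S \<subseteq> {..<N} \<and> T \<subseteq> {..<N} \<and> set_less less_than S T}"
    using set_less_trans[OF nat(1,3)] by (auto simp: trans_def)
  \<comment> \<open>All points of difference lie in \<open>T\<close>, so the least one does.\<close>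
  moreover have "set_less less_than S T" if "S \<subset> T" "T \<subseteq> {..<N}" for S T
    using set_less_total[OF nat finite_lessThan, of S T] that by (auto simp: set_less_def)
  moreover have "total_on (Pow {..<N}) {(S, T). S \<subseteq> {..<N} \<and> T \<subseteq> {..<N} \<and> set_less less_than S T}"
    using set_less_total[OF nat finite_lessThan] by (auto simp: total_on_def)
  moreover have "irrefl {(S, T). S \<subseteq> {..<N} \<and> T \<subseteq> {..<N} \<and> set_less less_than S T}"
    by (auto simp: irrefl_def set_less_irrefl)
  ultimately show ?thesis
    by (auto simp: finite_struct_def is_struct_def cube_def strict_partial_order_on_def 
      strict_linear_order_on_def irrefl_def intro: transI)
qed

definition decode :: "(nat \<Rightarrow> 'a set) \<Rightarrow> nat list \<Rightarrow> 'a \<Rightarrow> nat set" where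
  "decode u s x = {j. j < length s \<and> x \<in> u (s ! j)}"

text \<open>The principal upset \<open>up x\<close> occurs in \<open>s\<close> and contains, besides
  \<open>x\<close>, only points above \<open>x\<close>; this settles the partial order. For the
  linear order, the first position that separates two points must belong to the larger one.\<close>

lemma decode_embedding:
  assumes X: "finite_struct 1 X" and u: "upset_enum X k u" and s: "s \<in> Words 1 (1 + k) N"
  shows "embedding 1 X (cube N) (decode u s)"
proof -
  note X = finite_struct_1D[OF X]
  let ?L = "los X ! 0" and ?e = "decode u s"
  have param_word: "param_word 1 (Suc k) s" and len: "length s = N" using s by (auto simp: Words_def)
  have uU: "u i \<in> upsets (points X) (po X)" if "i \<le> k" for i
    using u that by (auto simp: upset_enum_def)
  have sk: "s ! j \<le> k" if "j < N" for j 
    using param_word_letters[OF param_word] len that nth_mem[of j s] by (auto simp: less_Suc_eq_le subset_iff)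
  have sub: "?e x \<subseteq> {..<N}" for x using len by (auto simp: decode_def)
  define up where "up x = insert x {y. (x, y) \<in> po X}" for x
  have upU: "\<exists>l. 1 \<le> l \<and> l \<le> k \<and> u l = up x" if "x \<in> points X" for x
  proof -
    have "up x \<in> upsets (points X) (po X)" 
      using that X(2,4) by (auto simp: up_def upsets_def dest: transD)
    then obtain l where l: "l \<le> k" "u l = up x" using u unfolding upset_enum_def by (metis atMost_iff imageE)
    moreover have "u l \<noteq> u 0" using l u by (simp add: upset_enum_def up_def)
    then have "l \<noteq> 0" by metis
    ultimately show ?thesis by (intro exI[of _ l]) auto
  qed
  have occurs: "\<exists>j < N. s ! j = l" if "1 \<le> l" "l \<le> k" for l
    using param_word_split[OF param_word, of l] that len by (metis in_set_conv_nth in_set_conv_decomp less_Suc_eq_le)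
  have occ: "\<exists>j < N. u (s ! j) = up x" if "x \<in> points X" for x 
    using upU[OF that] occurs by metis
  have P: "(x, y) \<in> po X \<longleftrightarrow> ?e x \<subset> ?e y" if xy: "x \<in> points X" "y \<in> points X" for x y
  proof
    assume a: "(x, y) \<in> po X"
    have "?e x \<subseteq> ?e y" using a uU sk len by (auto simp: decode_def upsets_def)
    moreover obtain j where j: "j < N" "u (s ! j) = up y" using occ xy by blast
    moreover have "x \<notin> up y" using a X(2,3) by (auto simp: up_def irrefl_def dest: transD)
    ultimately show "?e x \<subset> ?e y" using len by (auto simp: decode_def up_def)
  next
    assume a: "?e x \<subset> ?e y"
    obtain j where j: "j < N" "u (s ! j) = up x" using occ xy by blast
    then have "y \<in> up x" using a len by (auto simp: decode_def up_def)
    then show "(x, y) \<in> po X" using a by (auto simp: up_def)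
  qed
  have L: "set_less less_than (?e x) (?e y)" if xy: "x \<in> points X" "y \<in> points X" "(x, y) \<in> ?L" for x y
  proof -
    define dif where "dif j \<longleftrightarrow> j < N \<and> (x \<in> u (s ! j)) \<noteq> (y \<in> u (s ! j))" for j
    obtain l where l: "1 \<le> l" "l \<le> k" "u l = up y" using upU xy by blast
    have xl: "x \<notin> up y" 
      using xy X(6,7,9) by (auto simp: up_def irrefl_def dest: transD)
    obtain j0 where "j0 < N" "s ! j0 = l" using occurs l by blast
    then have "dif j0" using l xl by (auto simp: dif_def up_def)
    define j where "j = (LEAST j. dif j)"
    have j: "dif j" "\<And>i. i < j \<Longrightarrow> \<not> dif i" 
      unfolding j_def using LeastI[of dif, OF \<open>dif j0\<close>] not_less_Least by blast+
    have "y \<in> u (s ! j)"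
    proof (rule ccontr)
      assume ny: "y \<notin> u (s ! j)"
      then have x: "x \<in> u (s ! j)" "j < N" using j(1) by (auto simp: dif_def)
      let ?B = "u (s ! j)"
      have B: "?B \<subseteq> points X" using uU[OF sk[OF x(2)]] by (simp add: upsets_def)
      \<comment> \<open>The points of \<open>up y\<close> are at or after \<open>y\<close>, hence
        after \<open>x\<close>, while \<open>x\<close> lies in \<open>?B\<close> but not in
        \<open>up y\<close>. So the deciding point cannot be in \<open>up y\<close>.\<close>
      have "\<not> set_less ?L ?B (up y)"
      proof
        assume "set_less ?L ?B (up y)"
        then obtain m where m: "m \<in> up y - ?B" "\<And>i. (i, m) \<in> ?L \<Longrightarrow> i \<in> ?B \<longleftrightarrow> i \<in> up y"
          unfolding set_less_def by blast
        then have "m = y \<or> (y, m) \<in> ?L" using X(9) by (auto simp: up_def)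
        then have "(x, m) \<in> ?L" using xy(3) X(6) by (auto dest: transD)
        then show False using m(2) x xl by blast
      qed
      moreover have "up y \<noteq> ?B" "up y \<subseteq> points X" using x xl l uU[OF l(2)] by (auto simp: upsets_def)
      ultimately have "set_less ?L (u l) ?B" using set_less_total[OF X(6-8,1) _ B] l by metis
      \<comment> \<open>Then \<open>up y\<close> is listed before \<open>?B\<close>, so it occurs in
        \<open>s\<close> before position \<open>j\<close>, where it already separates
        \<open>x\<close> from \<open>y\<close>.\<close>
      then have "l < s ! j" using u l sk[OF x(2)] by (auto simp: upset_enum_def)
      then obtain i where "i < j" "s ! i = l" 
        using param_word_first_occurrence[OF param_word, of j l] x len l by auto
      then have "dif i" using l xl x by (auto simp: dif_def up_def)
      then show False using j(2) \<open>i < j\<close> by blast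
    qed
    then have "j \<in> ?e y - ?e x" using j(1) len by (auto simp: dif_def decode_def)
    moreover have "i \<in> ?e x \<longleftrightarrow> i \<in> ?e y" if "i < j" for i
      using j(2)[OF that] len by (auto simp: dif_def decode_def)
    ultimately show ?thesis unfolding set_less_def by auto
  qed
  have L': "(x, y) \<in> ?L" if xy: "x \<in> points X" "y \<in> points X" "set_less less_than (?e x) (?e y)" for x y
  proof (rule ccontr)
    assume "(x, y) \<notin> ?L"
    then have "x = y \<or> (y, x) \<in> ?L" using X(8) xy by (auto simp: total_on_def)
    moreover have "trans less_than" "total_on UNIV less_than" by (auto simp: total_on_def trans_less_than)
    ultimately show False using xy L[of y x] set_less_irrefl set_less_trans[of less_than UNIV "?e y" "?e x" "?e x"] 
      by (metis set_less_trans subset_UNIV)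
  qed
  show ?thesis
    unfolding embedding_def
  proof (intro conjI ballI allI impI)
    show "?e \<in> points X \<rightarrow> points (cube N)" using sub by (simp add: cube_def)
    fix x y i assume xy: "x \<in> points X" "y \<in> points X"
    show "(x, y) \<in> po X \<longleftrightarrow> (?e x, ?e y) \<in> po (cube N)"
      using P[OF xy] sub[of y] by (simp add: cube_def)
    assume "i < (1::nat)"
    then show "(x, y) \<in> los X ! i \<longleftrightarrow> (?e x, ?e y) \<in> los (cube N) ! i"
      using L[OF xy] L'[OF xy] sub by (auto simp: cube_def)
  qed
qed

text \<open>\<open>s\<close> gives, for each nonempty upset of \<open>Y\<close>, the number of its
  preimage under \<open>f\<close>. This makes the two decodings agree; the work lies in showing that
  \<open>s\<close> is a parameter word.\<close>

lemma pullback_word: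
  assumes X: "finite_struct 1 X" and Y: "finite_struct 1 Y" 
    and u: "upset_enum X k u" and v: "upset_enum Y m v" and f: "embedding 1 X Y f"
  shows "\<exists>s \<in> Words 1 (1 + k) m. \<forall>N. \<forall>G \<in> Words 1 (1 + m) N. \<forall>x \<in> points X. 
    decode u (sub 1 s G) x = decode v G (f x)"
proof -
  note X = finite_struct_1D[OF X] and Y = finite_struct_1D[OF Y]
  have fY: "\<And>x. x \<in> points X \<Longrightarrow> f x \<in> points Y"
    and fP: "\<And>x y. \<lbrakk>x \<in> points X; y \<in> points X\<rbrakk> \<Longrightarrow> (x, y) \<in> po X \<longleftrightarrow> (f x, f y) \<in> po Y"
    and fL: "\<And>x y. \<lbrakk>x \<in> points X; y \<in> points X\<rbrakk> \<Longrightarrow> (x, y) \<in> los X ! 0 \<longleftrightarrow> (f x, f y) \<in> los Y ! 0"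
    using f by (auto simp: embedding_def)
  define pb where "pb B = {x \<in> points X. f x \<in> B}" for B
  have uU: "u i \<in> upsets (points X) (po X)" if "i \<le> k" for i
    using u that by (auto simp: upset_enum_def)
  have vU: "v i \<in> upsets (points Y) (po Y)" if "i \<le> m" for i
    using v that by (auto simp: upset_enum_def)
  have u_inj: "i = j" if "u i = u j" "i \<le> k" "j \<le> k" for i j
    using u that set_less_irrefl unfolding upset_enum_def by (metis linorder_neqE_nat)
  have "\<exists>i \<le> k. u i = pb (v l)" if "l \<le> m" for l
  proof -
    have "pb (v l) \<in> upsets (points X) (po X)"
      using vU[OF that] fP X(4) by (fastforce simp: pb_def upsets_def)
    then show ?thesis using u unfolding upset_enum_def by (metis atMost_iff imageE)
  qed
  then obtain \<pi> where \<pi>: "\<And>l. l \<le> m \<Longrightarrow> \<pi> l \<le> k \<and> u (\<pi> l) = pb (v l)" by metis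
  \<comment> \<open>The list starts at \<open>1\<close>: the empty upset of \<open>Y\<close> has
    empty preimage, and \<open>ext 1 s\<close> fixes the letter \<open>0\<close>.\<close>
  define s where "s = map \<pi> [1..<1 + m]"
  have s_nth: "s ! i = \<pi> (Suc i)" if "i < m" for i using that by (simp add: s_def del: upt_Suc)
  have len: "length s = m" by (simp add: s_def)
  \<comment> \<open>The first occurrence of \<open>y\<close> is at the upset of \<open>Y\<close> generated by the image of \<open>u y\<close>.\<close>
  have least: "\<exists>l. 1 \<le> l \<and> l \<le> m \<and> \<pi> l = y \<and> (\<forall>l' \<le> m. y < \<pi> l' \<longrightarrow> l < l')" if y: "1 \<le> y" "y \<le> k" for y
  proof -
    define W where "W = {w. \<exists>x \<in> u y. w = f x \<or> (f x, w) \<in> po Y}"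
    have uy: "u y \<subseteq> points X" using uU y by (simp add: upsets_def)
    then have "W \<in> upsets (points Y) (po Y)"
      using fY Y(2,4) by (fastforce simp: W_def upsets_def dest: transD)
    then obtain l where l: "l \<le> m" "v l = W" using v unfolding upset_enum_def by (metis atMost_iff imageE)
    have "u y \<noteq> {}" using u_inj[of y 0] u y by (auto simp: upset_enum_def)
    then have "W \<noteq> {}" by (auto simp: W_def)
    then have "1 \<le> l" using l v by (cases l) (auto simp: upset_enum_def)
    have inj: "x = x'" if "f x = f x'" "x \<in> points X" "x' \<in> points X" for x x'
      using that fL[of x x'] fL[of x' x] X(8) Y(7) by (auto simp: total_on_def irrefl_def)
    have "pb W = u y"
      using uU[OF y(2)] uy inj fP by (fastforce simp: pb_def W_def upsets_def)
    then have "\<pi> l = y" using \<pi>[OF l(1)] l u_inj y by auto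
    moreover have "l < l'" if l': "l' \<le> m" "y < \<pi> l'" for l'
    proof -
      have "set_less (los X ! 0) (u y) (pb (v l'))" 
        using u \<pi>[OF l'(1)] l' y unfolding upset_enum_def by metis
      then obtain n where n: "n \<in> pb (v l')" "n \<notin> u y" 
        "\<And>i. (i, n) \<in> los X ! 0 \<Longrightarrow> i \<in> u y \<longleftrightarrow> i \<in> pb (v l')" unfolding set_less_def by blast
      have nX: "n \<in> points X" "f n \<in> v l'" using n by (auto simp: pb_def)
      have fn: "f n \<notin> W" using n(2) nX \<open>pb W = u y\<close> by (auto simp: pb_def)
      \<comment> \<open>If \<open>t\<close> decided for \<open>W\<close>, some \<open>f x\<close>
        with \<open>x\<close> in \<open>u y\<close> would be at or below \<open>t\<close>, hence
        before \<open>f n\<close>. Then \<open>x\<close> is before the deciding point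
        \<open>n\<close>, so \<open>f x\<close> lies in \<open>v l'\<close>, and so does
        \<open>t\<close>.\<close>
      have "\<not> set_less (los Y ! 0) (v l') W"
      proof
        assume "set_less (los Y ! 0) (v l') W"
        then obtain t where t: "t \<in> W" "t \<notin> v l'" 
          "\<And>i. (i, t) \<in> los Y ! 0 \<Longrightarrow> i \<in> v l' \<longleftrightarrow> i \<in> W" unfolding set_less_def by blast
        have "t \<in> points Y" using t(1) \<open>W \<in> _\<close> by (auto simp: upsets_def)
        moreover have "t \<noteq> f n" "(f n, t) \<notin> los Y ! 0" using t fn nX by auto
        ultimately have tn: "(t, f n) \<in> los Y ! 0" using Y(8) fY nX by (auto simp: total_on_def)
        obtain x where x: "x \<in> u y" "t = f x \<or> (f x, t) \<in> po Y" using t by (auto simp: W_def)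
        then have "(f x, f n) \<in> los Y ! 0" using tn Y(6,9) by (auto dest: transD)
        then have "f x \<in> v l'" using n(3)[of x] fL x uy nX by (auto simp: pb_def)
        then show False using x t(2) vU[OF l'(1)] by (auto simp: upsets_def)
      qed
      moreover have "W \<noteq> v l'" using fn nX by auto
      moreover have "W \<subseteq> points Y" "v l' \<subseteq> points Y" using \<open>W \<in> _\<close> vU[OF l'(1)] by (auto simp: upsets_def)
      ultimately have "set_less (los Y ! 0) (v l) (v l')" using set_less_total[OF Y(6-8,1)] l by metis
      then show "l < l'" using v l l' by (auto simp: upset_enum_def)
    qed
    ultimately show ?thesis using l \<open>1 \<le> l\<close> by blast
  qed
  have "param_word 1 (1 + k) s"
  proof (rule param_word_criterion)
    show "set s \<subseteq> {..<1 + k}" using \<pi> by (auto simp: s_def less_Suc_eq_le simp del: upt_Suc)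
    show "{1..<1 + k} \<subseteq> set s"
    proof
      fix y assume "y \<in> {1..<1 + k}"
      then obtain l where "1 \<le> l" "l \<le> m" "\<pi> l = y" using least[of y] by auto
      then show "y \<in> set s" by (force simp: s_def simp del: upt_Suc)
    qed
    show "\<exists>j<i. s ! j = y" if i: "i < length s" "1 \<le> y" "y < s ! i" for i y
    proof -
      have "y < \<pi> (Suc i)" "y \<le> k" using i s_nth[of i] \<pi>[of "Suc i"] len by auto
      then obtain l where l: "1 \<le> l" "l \<le> m" "\<pi> l = y" "l < Suc i" 
        using least[of y] i len by fastforce
      then have "s ! (l - 1) = y" "l - 1 < i" using s_nth[of "l - 1"] by auto
      then show ?thesis by blast
    qed
  qed simp
  then have sW: "s \<in> Words 1 (1 + k) m" using len by (simp add: Words_def)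
  have "decode u (sub 1 s G) x = decode v G (f x)" 
    if G: "G \<in> Words 1 (1 + m) N" and x: "x \<in> points X" for G N x
  proof -
    have "x \<in> u (ext 1 s l) \<longleftrightarrow> f x \<in> v l" if "l \<le> m" for l
    proof (cases l)
      case 0
      then show ?thesis using u v by (auto simp: ext_def upset_enum_def)
    next
      case (Suc i)
      then have "ext 1 s l = \<pi> l" using s_nth[of i] that by (simp add: ext_def)
      then show ?thesis using \<pi>[OF that] x by (simp add: pb_def)
    qed
    moreover have "G ! j \<le> m" if "j < length G" for j
      using Words_letters[OF G] nth_mem[OF that] by (auto simp: subset_iff less_Suc_eq_le)
    ultimately show ?thesis by (auto simp: decode_def)
  qed
  then show ?thesis using sW by blast
qed

text \<open>A word gets the colour of the embedding it decodes to. By \<open>pullback_word\<close>,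
  composing \<open>decode v G\<close> with an embedding of \<open>X\<close> into \<open>Y\<close>
  amounts to substituting a word into \<open>G\<close>, and all these results have the same
  colour.\<close>

lemma ramsey_1:
  assumes X: "finite_struct 1 X" and Y: "finite_struct 1 Y" and "0 < d"
  shows "\<exists>N. ramsey 1 d X Y (cube N)"
proof -
  obtain k u where u: "upset_enum X k u" using upset_enum_ex[OF X] by blast
  obtain m v where v: "upset_enum Y m v" using upset_enum_ex[OF Y] by blast
  obtain N where N: "arrows d 1 (1 + k) m (\<lambda>_ _. True) N" 
    using graham_rothschild[of 1 d k m] assms(3) by auto
  have "\<exists>g. embedding 1 Y (cube N) g \<and> (\<forall>f f'. embedding 1 X Y f \<longrightarrow> embedding 1 X Y f' \<longrightarrow> 
        c (compose (points X) g f) = c (compose (points X) g f'))"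
    if c: "c \<in> Emb 1 X (cube N) \<rightarrow> {..<d}" for c
  proof -
    have "(\<lambda>s. c (restrict (decode u s) (points X))) \<in> Words 1 (1 + k) N \<rightarrow> {..<d}"
      using c restrict_Emb[OF decode_embedding[OF X u]] by blast
    then obtain G where G: "G \<in> Words 1 (1 + m) N" and
      Gc: "\<And>g g'. \<lbrakk>g \<in> Words 1 (1 + k) m; g' \<in> Words 1 (1 + k) m\<rbrakk> \<Longrightarrow> 
        c (restrict (decode u (sub 1 g G)) (points X)) = c (restrict (decode u (sub 1 g' G)) (points X))"
      by (rule arrowsE[OF N]) blast
    have *: "\<exists>s \<in> Words 1 (1 + k) m. compose (points X) (decode v G) f = restrict (decode u (sub 1 s G)) (points X)"
      if f: "embedding 1 X Y f" for f
    proof -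
      obtain s where "s \<in> Words 1 (1 + k) m" "\<And>x. x \<in> points X \<Longrightarrow> decode u (sub 1 s G) x = decode v G (f x)"
        using pullback_word[OF X Y u v f] G by blast
      then show ?thesis by (intro bexI[of _ s]) (auto simp: compose_def restrict_def fun_eq_iff)
    qed
    show ?thesis
    proof (intro exI[of _ "decode v G"] conjI allI impI)
      show "embedding 1 Y (cube N) (decode v G)" by (rule decode_embedding[OF Y v G])
      fix f f' assume "embedding 1 X Y f" "embedding 1 X Y f'"
      then show "c (compose (points X) (decode v G) f) = c (compose (points X) (decode v G) f')"
        using *[of f] *[of f'] Gc by metis
    qed
  qed
  then show ?thesis unfolding ramsey_def using finite_struct_cube by blast
qed

section \<open>Several linear extensions\<close>

lemma embedding_inj:
  assumes "0 < p" "finite_struct p X" "finite_struct p Y" "embedding p X Y f"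
  shows "inj_on f (points X)"
proof (rule inj_onI, rule ccontr)
  fix x y assume xy: "x \<in> points X" "y \<in> points X" "f x = f y" "x \<noteq> y"
  have "total_on (points X) (los X ! 0)" "irrefl (los Y ! 0)"
    using assms(1-3) by (auto simp: finite_struct_def is_struct_def strict_linear_order_on_def)
  then have "(x, y) \<in> los X ! 0 \<or> (y, x) \<in> los X ! 0" "(f x, f x) \<notin> los Y ! 0"
    using xy by (auto simp: total_on_def irrefl_def)
  moreover have "(u, v) \<in> los X ! 0 \<longleftrightarrow> (f u, f v) \<in> los Y ! 0" if "u \<in> points X" "v \<in> points X" for u v
    using assms(1,4) that by (auto simp: embedding_def)
  ultimately show False using xy by metis
qed

definition pullback :: "'a set \<Rightarrow> ('a \<Rightarrow> 'b) \<Rightarrow> 'b ord_struct \<Rightarrow> 'a ord_struct" where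
  "pullback A i Z = \<lparr>points = A, po = {(x, y). x \<in> A \<and> y \<in> A \<and> (i x, i y) \<in> po Z},
     los = map (\<lambda>L. {(x, y). x \<in> A \<and> y \<in> A \<and> (i x, i y) \<in> L}) (los Z)\<rparr>"

lemma finite_struct_pullback:
  assumes Z: "finite_struct p Z" and i: "inj_on i A" "i ` A \<subseteq> points Z" and "finite A"
  shows "finite_struct p (pullback A i Z)"
proof -
  have *: "trans {(x, y). x \<in> A \<and> y \<in> A \<and> (i x, i y) \<in> R}" if "trans R" for R
    using that by (auto simp: trans_def)
  have "total_on A {(x, y). x \<in> A \<and> y \<in> A \<and> (i x, i y) \<in> R}" if "total_on (points Z) R" for R
  proof (rule total_onI)
    fix x y assume xy: "x \<in> A" "y \<in> A" "x \<noteq> y"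
    then have "i x \<noteq> i y" "i x \<in> points Z" "i y \<in> points Z" using i by (auto simp: inj_on_def)
    then have "(i x, i y) \<in> R \<or> (i y, i x) \<in> R" using that by (simp add: total_on_def)
    then show "(x, y) \<in> {(x, y). x \<in> A \<and> y \<in> A \<and> (i x, i y) \<in> R} \<or> 
      (y, x) \<in> {(x, y). x \<in> A \<and> y \<in> A \<and> (i x, i y) \<in> R}" using xy by simp
  qed
  with * show ?thesis
    using Z \<open>finite A\<close> unfolding finite_struct_def is_struct_def pullback_def 
      strict_partial_order_on_def strict_linear_order_on_def
    by (auto simp: irrefl_def)
qed

text \<open>Products change the type of points; moving back to \<open>nat\<close> lets the induction
  on \<open>p\<close> stay within one type.\<close>

lemma ramsey_nat:
  assumes "ramsey p d X Y Z"
  shows "\<exists>Z' :: nat ord_struct. ramsey p d X Y Z'"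
proof -
  have fin: "finite_struct p Z" using assms by (simp add: ramsey_def)
  then have "finite (points Z)" by (simp add: finite_struct_def)
  then obtain e :: "'c \<Rightarrow> nat" where e: "inj_on e (points Z)" using finite_imp_inj_to_nat_seg by blast
  define i where "i = inv_into (points Z) e"
  have ie: "i (e z) = z" if "z \<in> points Z" for z using that e by (simp add: i_def)
  define Z' where "Z' = pullback (e ` points Z) i Z"
  have len: "length (los Z) = p" using fin by (simp add: finite_struct_def is_struct_def)
  have "finite_struct p Z'"
    unfolding Z'_def using fin ie
    by (intro finite_struct_pullback) (auto simp: inj_on_def finite_struct_def)
  moreover have emb: "embedding p Z Z' e"
    using len ie by (auto simp: embedding_def Z'_def pullback_def)
  moreover have "\<exists>g. embedding p Y Z' g \<and> (\<forall>f f'. embedding p X Y f \<longrightarrow> embedding p X Y f' \<longrightarrow> 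
        c (compose (points X) g f) = c (compose (points X) g f'))"
    if c: "c \<in> Emb p X Z' \<rightarrow> {..<d}" for c
  proof -
    have "compose (points X) e h \<in> Emb p X Z'" if "h \<in> Emb p X Z" for h
      using compose_Emb[of p X Z h Z' e] emb that by (simp add: Emb_def)
    then have "(\<lambda>h. c (compose (points X) e h)) \<in> Emb p X Z \<rightarrow> {..<d}" using c by blast
    then obtain g where g: "embedding p Y Z g" and gc: "\<And>f f'. \<lbrakk>embedding p X Y f; embedding p X Y f'\<rbrakk> \<Longrightarrow>
        c (compose (points X) e (compose (points X) g f)) = c (compose (points X) e (compose (points X) g f'))"
      using assms unfolding ramsey_def by (metis (no_types, lifting))
    have "compose (points X) e (compose (points X) g f) = compose (points X) (\<lambda>y. e (g y)) f" for f
      by (auto simp: compose_def)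
    then show ?thesis using gc embedding_comp[OF g emb] by metis
  qed
  ultimately show ?thesis unfolding ramsey_def by blast
qed

lemma finite_Emb:
  assumes "finite (points X)" "finite (points Z)"
  shows "finite (Emb p X Z)"
proof -
  have "Emb p X Z \<subseteq> points X \<rightarrow>\<^sub>E points Z" by (auto simp: Emb_def embedding_def PiE_def)
  then show ?thesis using finite_PiE[of "points X" "\<lambda>_. points Z"] assms finite_subset by blast
qed

text \<open>As with \<open>arrowsD\<close>, colours from any finite set; here they will be
  functions.\<close>

lemma ramseyD:
  fixes c :: "('a \<Rightarrow> 'z) \<Rightarrow> 'k"
  assumes "ramsey p (card C) X Y Z" "finite C" "c \<in> Emb p X Z \<rightarrow> C"
  obtains g where "embedding p Y Z g"
    "\<And>f f'. \<lbrakk>embedding p X Y f; embedding p X Y f'\<rbrakk> \<Longrightarrow> c (compose (points X) g f) = c (compose (points X) g f')"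
proof -
  obtain e :: "'k \<Rightarrow> nat" where e: "inj_on e C" "e ` C = {..<card C}" 
    using recolour assms(2) by blast
  then have "e \<circ> c \<in> Emb p X Z \<rightarrow> {..<card C}" using assms(3) by fastforce
  then obtain g where g: "embedding p Y Z g" 
    "\<And>f f'. \<lbrakk>embedding p X Y f; embedding p X Y f'\<rbrakk> \<Longrightarrow> e (c (compose (points X) g f)) = e (c (compose (points X) g f'))"
    using assms(1) unfolding ramsey_def by (metis comp_apply)
  show ?thesis
  proof (rule that[OF g(1)])
    fix f f' assume f: "embedding p X Y f" "embedding p X Y f'"
    have "c (compose (points X) g f) \<in> C" "c (compose (points X) g f') \<in> C"
      using assms(3) compose_Emb[OF f(1) g(1)] compose_Emb[OF f(2) g(1)] by blast+
    then show "c (compose (points X) g f) = c (compose (points X) g f')" 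
      using g(2)[OF f] e(1) by (meson inj_onD)
  qed
qed

section \<open>Products of structures\<close>

definition lex_on :: "'a set \<Rightarrow> 'b set \<Rightarrow> 'a rel \<Rightarrow> 'b rel \<Rightarrow> ('a \<times> 'b) rel" where
  "lex_on A B L M = {((a, b), (a', b')). a \<in> A \<and> a' \<in> A \<and> b \<in> B \<and> b' \<in> B \<and> 
     ((a, a') \<in> L \<or> a = a' \<and> (b, b') \<in> M)}"

definition colex_on :: "'a set \<Rightarrow> 'b set \<Rightarrow> 'a rel \<Rightarrow> 'b rel \<Rightarrow> ('a \<times> 'b) rel" where
  "colex_on A B L M = {((a, b), (a', b')). a \<in> A \<and> a' \<in> A \<and> b \<in> B \<and> b' \<in> B \<and> 
     ((b, b') \<in> M \<or> b = b' \<and> (a, a') \<in> L)}"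

lemma linear_lex_on:
  assumes "strict_linear_order_on A L" "strict_linear_order_on B M"
  shows "strict_linear_order_on (A \<times> B) (lex_on A B L M)"
proof -
  have "trans L" "irrefl L" "total_on A L" "trans M" "irrefl M" "total_on B M"
    using assms by (auto simp: strict_linear_order_on_def)
  then have "trans (lex_on A B L M)" "irrefl (lex_on A B L M)" "total_on (A \<times> B) (lex_on A B L M)"
    by (auto simp: lex_on_def trans_def irrefl_def total_on_def; blast)+
  then show ?thesis by (simp add: strict_linear_order_on_def)
qed

lemma linear_colex_on:
  assumes "strict_linear_order_on A L" "strict_linear_order_on B M"
  shows "strict_linear_order_on (A \<times> B) (colex_on A B L M)"
proof -
  have "trans L" "irrefl L" "total_on A L" "trans M" "irrefl M" "total_on B M"
    using assms by (auto simp: strict_linear_order_on_def)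
  then have "trans (colex_on A B L M)" "irrefl (colex_on A B L M)" "total_on (A \<times> B) (colex_on A B L M)"
    by (auto simp: colex_on_def trans_def irrefl_def total_on_def; blast)+
  then show ?thesis by (simp add: strict_linear_order_on_def)
qed

text \<open>Both coordinates have to be strictly related in the partial order, so it is contained in
  the linear orders led by either coordinate.\<close>

definition prod_struct :: "'a ord_struct \<Rightarrow> 'b ord_struct \<Rightarrow> ('a \<times> 'b) ord_struct" where
  "prod_struct Z W = \<lparr>points = points Z \<times> points W, 
     po = {((a, b), (a', b')). (a, a') \<in> po Z \<and> (b, b') \<in> po W},
     los = map (\<lambda>L. lex_on (points Z) (points W) L (los W ! 0)) (los Z) @ 
       [colex_on (points Z) (points W) (los Z ! 0) (los W ! 0)]\<rparr>"

lemma finite_struct_prod: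
  assumes "0 < p" and Z: "finite_struct p Z" and W: "finite_struct 1 W"
  shows "finite_struct (Suc p) (prod_struct Z W)"
proof -
  note W = finite_struct_1D[OF W] W
  have Z1: "po Z \<subseteq> points Z \<times> points Z" "trans (po Z)" "irrefl (po Z)" "length (los Z) = p" 
    "finite (points Z)"
    and Z2: "\<And>i. i < p \<Longrightarrow> strict_linear_order_on (points Z) (los Z ! i)" 
    "\<And>i. i < p \<Longrightarrow> po Z \<subseteq> los Z ! i"
    using Z by (auto simp: finite_struct_def is_struct_def strict_partial_order_on_def)
  have W2: "strict_linear_order_on (points W) (los W ! 0)" 
    using W by (simp add: strict_linear_order_on_def)
  let ?P = "prod_struct Z W"
  have nth: "los ?P ! i = (if i < p then lex_on (points Z) (points W) (los Z ! i) (los W ! 0)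
      else colex_on (points Z) (points W) (los Z ! 0) (los W ! 0))" if "i < Suc p" for i
    using that Z1(4) by (auto simp: prod_struct_def nth_append less_Suc_eq)
  have "strict_partial_order_on (points ?P) (po ?P)"
    using Z1 W(1-9) by (auto simp: strict_partial_order_on_def prod_struct_def irrefl_def trans_def; blast)
  moreover have "strict_linear_order_on (points ?P) (los ?P ! i)" if "i < Suc p" for i
    using nth[OF that] linear_lex_on[OF Z2(1) W2] linear_colex_on[OF Z2(1)[OF assms(1)] W2] 
    by (auto simp: prod_struct_def)
  moreover have "los ?P ! i \<subseteq> points ?P \<times> points ?P" if "i < Suc p" for i
    using nth[OF that] by (auto simp: prod_struct_def lex_on_def colex_on_def)
  moreover have "po ?P \<subseteq> los ?P ! i" if "i < Suc p" for i
  proof clarify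
    fix a b a' b' assume "((a, b), (a', b')) \<in> po ?P"
    then have "(a, a') \<in> po Z" "(b, b') \<in> po W" by (auto simp: prod_struct_def)
    then show "((a, b), (a', b')) \<in> los ?P ! i"
      unfolding nth[OF that] using W(4,9) Z1(1) Z2(2)[of i] by (auto simp: lex_on_def colex_on_def)
  qed
  moreover have "length (los ?P) = Suc p" "finite (points ?P)" 
    using Z1 W by (auto simp: prod_struct_def)
  ultimately show ?thesis by (auto simp: finite_struct_def is_struct_def)
qed

definition init_struct :: "nat \<Rightarrow> 'a ord_struct \<Rightarrow> 'a ord_struct" where
  "init_struct p X = \<lparr>points = points X, po = po X, los = take p (los X)\<rparr>"

definition last_struct :: "nat \<Rightarrow> 'a ord_struct \<Rightarrow> 'a ord_struct" where
  "last_struct p X = \<lparr>points = points X, po = po X, los = [los X ! p]\<rparr>"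

lemma points_reduct [simp]: "points (init_struct p X) = points X" "points (last_struct p X) = points X"
  by (simp_all add: init_struct_def last_struct_def)

lemma finite_struct_reduct:
  assumes "finite_struct (Suc p) X"
  shows "finite_struct p (init_struct p X)" "finite_struct 1 (last_struct p X)"
  using assms by (auto simp: finite_struct_def is_struct_def init_struct_def last_struct_def)

lemma embedding_reduct:
  assumes "embedding (Suc p) X Y f" 
  shows "embedding p (init_struct p X) (init_struct p Y) f" "embedding 1 (last_struct p X) (last_struct p Y) f"
  using assms by (auto simp: embedding_def init_struct_def last_struct_def)

text \<open>Both components are injective, so distinct points of \<open>X\<close> differ in both
  coordinates, and each linear order of the product compares their images by its leading
  coordinate.\<close>

lemma embedding_prod:
  assumes "0 < p" and X: "finite_struct (Suc p) X" and Z: "finite_struct p Z" and W: "finite_struct 1 W"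
    and f: "embedding p (init_struct p X) Z f" and h: "embedding 1 (last_struct p X) W h"
  shows "embedding (Suc p) X (prod_struct Z W) (\<lambda>x. (f x, h x))"
proof -
  have fin: "inj_on f (points X)" "inj_on h (points X)"
    using embedding_inj[OF assms(1) finite_struct_reduct(1)[OF X] Z f] 
      embedding_inj[OF _ finite_struct_reduct(2)[OF X] W h] by simp_all
  have len: "length (los Z) = p" using Z by (simp add: finite_struct_def is_struct_def)
  have irr: "irrefl (los Z ! 0)" "irrefl (los W ! 0)" 
    using Z W assms(1) by (auto simp: finite_struct_def is_struct_def strict_linear_order_on_def)
  have f: "\<And>x. x \<in> points X \<Longrightarrow> f x \<in> points Z"
      "\<And>x y. \<lbrakk>x \<in> points X; y \<in> points X\<rbrakk> \<Longrightarrow> (x, y) \<in> po X \<longleftrightarrow> (f x, f y) \<in> po Z"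
      "\<And>x y i. \<lbrakk>x \<in> points X; y \<in> points X; i < p\<rbrakk> \<Longrightarrow> (x, y) \<in> los X ! i \<longleftrightarrow> (f x, f y) \<in> los Z ! i"
    using f by (auto simp: embedding_def init_struct_def)
  have h: "\<And>x. x \<in> points X \<Longrightarrow> h x \<in> points W"
      "\<And>x y. \<lbrakk>x \<in> points X; y \<in> points X\<rbrakk> \<Longrightarrow> (x, y) \<in> po X \<longleftrightarrow> (h x, h y) \<in> po W"
      "\<And>x y. \<lbrakk>x \<in> points X; y \<in> points X\<rbrakk> \<Longrightarrow> (x, y) \<in> los X ! p \<longleftrightarrow> (h x, h y) \<in> los W ! 0"
    using h by (auto simp: embedding_def last_struct_def)
  show ?thesis
    unfolding embedding_def
  proof (intro conjI ballI allI impI)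
    show "(\<lambda>x. (f x, h x)) \<in> points X \<rightarrow> points (prod_struct Z W)"
      using f(1) h(1) by (simp add: prod_struct_def)
    fix x y i assume xy: "x \<in> points X" "y \<in> points X"
    show "(x, y) \<in> po X \<longleftrightarrow> ((f x, h x), (f y, h y)) \<in> po (prod_struct Z W)"
      using f(2)[OF xy] h(2)[OF xy] by (simp add: prod_struct_def)
    have pts: "f x \<in> points Z" "f y \<in> points Z" "h x \<in> points W" "h y \<in> points W" using f(1) h(1) xy by auto
    have ne: "f x = f y \<longrightarrow> (h x, h y) \<notin> los W ! 0" "h x = h y \<longrightarrow> (f x, f y) \<notin> los Z ! 0"
      using fin irr xy by (auto simp: inj_on_def irrefl_def)
    assume "i < Suc p"
    then consider "i < p" | "i = p" by linarith
    then show "(x, y) \<in> los X ! i \<longleftrightarrow> ((f x, h x), (f y, h y)) \<in> los (prod_struct Z W) ! i"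
    proof cases
      case 1
      then show ?thesis using f(3)[OF xy 1] ne pts len 
        by (auto simp: prod_struct_def nth_append lex_on_def)
    next
      case 2
      then show ?thesis using h(3)[OF xy] ne pts len 
        by (auto simp: prod_struct_def nth_append lex_on_def colex_on_def)
    qed
  qed
qed

text \<open>An embedding into \<open>W\<close> is coloured by the colouring it induces on the embeddings into \<open>Z\<close>.\<close>

lemma ramsey_prod:
  assumes "0 < p" "0 < d" and X: "finite_struct (Suc p) X" and Y: "finite_struct (Suc p) Y"
    and Z: "ramsey p d (init_struct p X) (init_struct p Y) Z"
    and W: "ramsey 1 (card (Emb p (init_struct p X) Z \<rightarrow>\<^sub>E {..<d})) (last_struct p X) (last_struct p Y) W"
  shows "ramsey (Suc p) d X Y (prod_struct Z W)"
proof -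
  let ?V = "points X" and ?EZ = "Emb p (init_struct p X) Z" and ?EW = "Emb 1 (last_struct p X) W"
  have finZ: "finite_struct p Z" and finW: "finite_struct 1 W" using Z W by (auto simp: ramsey_def)
  have finE: "finite ?EZ" 
    using X finZ by (intro finite_Emb) (auto simp: finite_struct_def)
  then have finC: "finite (?EZ \<rightarrow>\<^sub>E {..<d})" by (intro finite_PiE) auto
  define pair where "pair f h = restrict (\<lambda>x. (f x, h x)) ?V" for f :: "'a \<Rightarrow> 'c" and h :: "'a \<Rightarrow> 'd"
  have pair: "pair f h \<in> Emb (Suc p) X (prod_struct Z W)" if "f \<in> ?EZ" "h \<in> ?EW" for f h
    unfolding pair_def using that 
    by (intro restrict_Emb embedding_prod[OF assms(1) X finZ finW]) (auto simp: Emb_def)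
  have "\<exists>g. embedding (Suc p) Y (prod_struct Z W) g \<and> 
      (\<forall>f f'. embedding (Suc p) X Y f \<longrightarrow> embedding (Suc p) X Y f' \<longrightarrow> c (compose ?V g f) = c (compose ?V g f'))"
    if c: "c \<in> Emb (Suc p) X (prod_struct Z W) \<rightarrow> {..<d}" for c
  proof -
    have "(\<lambda>h. restrict (\<lambda>f. c (pair f h)) ?EZ) \<in> ?EW \<rightarrow> (?EZ \<rightarrow>\<^sub>E {..<d})"
      using pair c by auto
    then obtain k where k: "embedding 1 (last_struct p Y) W k" and
      kc: "\<And>h h'. \<lbrakk>embedding 1 (last_struct p X) (last_struct p Y) h; 
             embedding 1 (last_struct p X) (last_struct p Y) h'\<rbrakk> \<Longrightarrow>
        restrict (\<lambda>f. c (pair f (compose ?V k h))) ?EZ = restrict (\<lambda>f. c (pair f (compose ?V k h'))) ?EZ"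
      by (rule ramseyD[OF W finC, unfolded points_reduct]) blast
    have kE: "compose ?V k h \<in> ?EW" if "embedding 1 (last_struct p X) (last_struct p Y) h" for h
      using compose_Emb[OF that k] by simp
    \<comment> \<open>By \<open>kc\<close>, all second components that come from embeddings of
      \<open>X\<close> into \<open>Y\<close> give the same colour, so one fixed choice
      \<open>f0\<close> represents them. If there is none, the value \<open>0\<close> keeps
      \<open>c0\<close> a colouring.\<close>
    define f0 where "f0 = (SOME f. embedding (Suc p) X Y f)"
    define c0 where "c0 f = (if \<exists>f. embedding (Suc p) X Y f then c (pair f (compose ?V k f0)) else 0)" for f
    have f0: "embedding (Suc p) X Y f0" if "\<exists>f. embedding (Suc p) X Y f"
      unfolding f0_def using someI_ex[OF that] .
    have "c0 f < d" if "f \<in> ?EZ" for f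
      using c pair[OF that kE[OF embedding_reduct(2)[OF f0]]] assms(2) unfolding c0_def by auto
    then have c0: "c0 \<in> ?EZ \<rightarrow> {..<d}" by simp
    have "ramsey p (card {..<d}) (init_struct p X) (init_struct p Y) Z" using Z by simp
    then obtain g where g: "embedding p (init_struct p Y) Z g" and
      gc: "\<And>f f'. \<lbrakk>embedding p (init_struct p X) (init_struct p Y) f; 
             embedding p (init_struct p X) (init_struct p Y) f'\<rbrakk> \<Longrightarrow>
        c0 (compose ?V g f) = c0 (compose ?V g f')"
      by (rule ramseyD[OF _ finite_lessThan c0, unfolded points_reduct]) blast
    let ?g = "\<lambda>y. (g y, k y)"
    have "c (compose ?V ?g f) = c0 (compose ?V g f)" if f: "embedding (Suc p) X Y f" for f
    proof -
      have "compose ?V ?g f = pair (compose ?V g f) (compose ?V k f)"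
        by (auto simp: pair_def compose_def restrict_def)
      moreover have gE: "compose ?V g f \<in> ?EZ" 
        using compose_Emb[OF embedding_reduct(1)[OF f] g] by simp
      moreover have "embedding (Suc p) X Y f0" using f0 f by blast
      \<comment> \<open>The second component changes from \<open>f\<close> to \<open>f0\<close>
        while the first one stays.\<close>
      from fun_cong[OF kc[OF embedding_reduct(2)[OF f] embedding_reduct(2)[OF this]], of "compose ?V g f"]
      have "c (pair (compose ?V g f) (compose ?V k f)) = c (pair (compose ?V g f) (compose ?V k f0))"
        unfolding restrict_apply'[OF gE] .
      moreover have "c0 (compose ?V g f) = c (pair (compose ?V g f) (compose ?V k f0))"
        unfolding c0_def by (rule if_P) (use f in blast)
      ultimately show ?thesis by (simp only:)
    qed
    then have "c (compose ?V ?g f) = c (compose ?V ?g f')" 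
      if "embedding (Suc p) X Y f" "embedding (Suc p) X Y f'" for f f'
      using gc[OF that[THEN embedding_reduct(1)]] that by metis
    then show ?thesis using embedding_prod[OF assms(1) Y finZ finW g k] by blast
  qed
  then show ?thesis unfolding ramsey_def using finite_struct_prod[OF assms(1) finZ finW] by blast
qed

text \<open>Induction on \<open>p\<close>: \<open>Z\<close> is chosen for all orders but the last,
  then a cube for the last one, with as many colours as there are colourings of the embeddings into
  \<open>Z\<close>.\<close>

lemma ramsey_exists:
  fixes X :: "'a ord_struct" and Y :: "'b ord_struct"
  assumes "0 < p" "0 < d" "finite_struct p X" "finite_struct p Y"
  shows "\<exists>Z :: nat ord_struct. ramsey p d X Y Z"
  using assms
proof (induction p arbitrary: X Y rule: nat_induct_non_zero)
  case 1
  then show ?case using ramsey_1 ramsey_nat by metis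
next
  case (Suc p)
  note X = finite_struct_reduct[OF \<open>finite_struct (Suc p) X\<close>] 
    and Y = finite_struct_reduct[OF \<open>finite_struct (Suc p) Y\<close>]
  obtain Z :: "nat ord_struct" where Z: "ramsey p d (init_struct p X) (init_struct p Y) Z"
    using Suc.IH X(1) Y(1) Suc.prems by blast
  let ?C = "Emb p (init_struct p X) Z \<rightarrow>\<^sub>E {..<d}"
  have "finite ?C" 
    using X(1) Z by (intro finite_PiE finite_Emb) (auto simp: ramsey_def finite_struct_def)
  \<comment> \<open>A constant colouring shows that the number of colours is positive, as
    \<open>ramsey_1\<close> requires.\<close>
  moreover have "(\<lambda>f \<in> Emb p (init_struct p X) Z. 0) \<in> ?C" using Suc.prems by auto
  ultimately have "0 < card ?C" using card_gt_0_iff by blast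
  then obtain N where "ramsey 1 (card ?C) (last_struct p X) (last_struct p Y) (cube N)"
    using ramsey_1[OF X(2) Y(2)] by blast
  from ramsey_prod[OF Suc.hyps \<open>0 < d\<close> Suc.prems(2,3) Z this] show ?case by (rule ramsey_nat)
qed

section \<open>From embeddings to copies\<close>

lemma restrict_restrict_struct:
  "B \<subseteq> A \<Longrightarrow> restrict_struct (restrict_struct Z A) B = restrict_struct Z B"
  by (simp add: restrict_struct_def Int_absorb1 Int_absorb2 Int_assoc) blast

theorem theorem1:
  fixes p d :: nat
    and X :: "'a ord_struct"
    and Y :: "'b ord_struct"
  assumes "p > 0"
    and "d > 0"
    and "finite_struct p X"
    and "finite_struct p Y"
  shows "\<exists>Z :: nat ord_struct. finite_struct p Z \<and>
           (\<forall>c :: nat ord_struct \<Rightarrow> nat. c \<in> copies p X Z \<rightarrow> {..<d} \<longrightarrow>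
              (\<exists>Y' \<in> copies p Y Z.
                 \<forall>A \<in> copies p X Y'. \<forall>B \<in> copies p X Y'. c A = c B))"
proof -
  obtain Z :: "nat ord_struct" where Z: "ramsey p d X Y Z" using ramsey_exists[OF assms] by blast
  then have finZ: "finite_struct p Z" by (simp add: ramsey_def)
  have "\<exists>Y' \<in> copies p Y Z. \<forall>A \<in> copies p X Y'. \<forall>B \<in> copies p X Y'. c A = c B"
    if c: "c \<in> copies p X Z \<rightarrow> {..<d}" for c :: "nat ord_struct \<Rightarrow> nat"
  proof -
    \<comment> \<open>An embedding gets the colour of the copy that is its image.\<close>
    define c' where "c' h = c (restrict_struct Z (h ` points X))" for h
    have "c' \<in> Emb p X Z \<rightarrow> {..<d}" using c by (auto simp: c'_def Emb_def copies_def)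
    then obtain g where g: "embedding p Y Z g" and 
      gc: "\<And>f f'. \<lbrakk>embedding p X Y f; embedding p X Y f'\<rbrakk> \<Longrightarrow> c' (compose (points X) g f) = c' (compose (points X) g f')"
      using Z unfolding ramsey_def by blast
    let ?S = "g ` points Y"
    let ?Y = "restrict_struct Z ?S"
    have inj: "inj_on g (points Y)" using embedding_inj[OF assms(1,4) finZ g] .
    have len: "length (los Z) = p" using finZ by (simp add: finite_struct_def is_struct_def)
    \<comment> \<open>Going back along \<open>g\<close>, a copy of \<open>X\<close> inside the copy
      of \<open>Y\<close> comes from an embedding of \<open>X\<close> into \<open>Y\<close>.\<close>
    have *: "\<exists>f. embedding p X Y f \<and> c A = c' (compose (points X) g f)" if A: "A \<in> copies p X ?Y" for A
    proof -
      obtain h where h: "embedding p X ?Y h" "A = restrict_struct ?Y (h ` points X)"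
        using A by (auto simp: copies_def)
      have hS: "h x \<in> ?S" if "x \<in> points X" for x
        using h(1) that by (auto simp: embedding_def restrict_struct_def)
      define f where "f x = inv_into (points Y) g (h x)" for x
      have gf: "g (f x) = h x" and fY: "f x \<in> points Y" if "x \<in> points X" for x
        using hS[OF that] by (auto simp: f_def f_inv_into_f inv_into_into)
      have "embedding p X Y f"
        unfolding embedding_def
      proof (intro conjI ballI allI impI)
        show "f \<in> points X \<rightarrow> points Y" using fY by blast
        fix x y i assume xy: "x \<in> points X" "y \<in> points X"
        show "(x, y) \<in> po X \<longleftrightarrow> (f x, f y) \<in> po Y"
          using h(1) g xy hS[OF xy(1)] hS[OF xy(2)] fY[OF xy(1)] fY[OF xy(2)] gf[OF xy(1)] gf[OF xy(2)]
          by (auto simp: embedding_def restrict_struct_def)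
        assume "i < p"
        then show "(x, y) \<in> los X ! i \<longleftrightarrow> (f x, f y) \<in> los Y ! i"
          using h(1) g xy hS[OF xy(1)] hS[OF xy(2)] fY[OF xy(1)] fY[OF xy(2)] gf[OF xy(1)] gf[OF xy(2)] len
          by (auto simp: embedding_def restrict_struct_def)
      qed
      moreover have "A = restrict_struct Z (h ` points X)"
        using h(2) hS by (simp add: restrict_restrict_struct image_subset_iff)
      moreover have "compose (points X) g f ` points X = h ` points X"
        using gf by (auto simp: compose_def)
      ultimately show ?thesis by (auto simp: c'_def)
    qed
    have "?Y \<in> copies p Y Z" using g by (auto simp: copies_def)
    moreover have "c A = c B" if "A \<in> copies p X ?Y" "B \<in> copies p X ?Y" for A B
      using *[OF that(1)] *[OF that(2)] gc by metis
    ultimately show ?thesis by blast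
  qed
  then show ?thesis using finZ by blast
qed

end
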